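(* Let $M = M^0(S; F(I), G(\Lambda); P)$ be a finitely generated Rees matrix semigroup with zero over a semigroupoid $S$. If $S$ is prefix-automatic, and the set of non-identity elements in $S$ is weakly right-ideal-generated by a row cross-section of $P$, then $M$ is prefix-automatic.
   Context: Semigroupoids. A (directed) graph $X$ has a set $X^0$ of vertices, a set $X^1$ of edges, and source and target maps $\alpha,\omega: X^1\to X^0$. A semigroupoid $S$ is a small graph (vertices are called objects, edges are called arrows) with a partial multiplication on arrows such that $ef$ is defined if and only if $\omega(e)=\alpha(f)$, in which case $\alpha(ef)=\alpha(e)$ and $\omega(ef)=\omega(f)$, and $e(fg)=(ef)g$ whenever $ef$ and $fg$ are defined. (Thus a semigroupoid is a small category without the requirement of identities.) We write $s\in S$ for $s\in S^1$. $S$ is isolation-free if every object is the source or target of some arrow. A semigroup is regarded as a semigroupoid with one object. An identity element of $S$ is an arrow $e$ with $\alpha(e)=\omega(e)$ such that $es=s$ and $te=t$ whenever these products are defined. Paths and regularity. For a graph $X$, $X^+$ is the free semigroupoid on $X$: its objects are $X^0$, its arrows are the non-empty paths $e_1\cdots e_n$ with $\omega(e_i)=\alpha(e_{i+1})$. All graphs over which regularity is considered are finite. A language $L\subseteq X^+$ is regular if it is regular in the usual sense as a set of words over the alphabet $X^1$ (equivalently, it is accepted by a finite automaton labelled by the graph $X$). Let $X^{\$}$ be $X$ with one extra loop $\$_s$ at each vertex $s$. For $(a,b)\in X^+\times X^+$, let $\delta_X(a,b)\in (X^{\$}\times X^{\$})^+$ be the path obtained by padding the shorter of $a,b$ on the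 right with copies of $\$_t$, where $t$ is the target of that shorter path, to the length of the longer one, and reading the two paths as a single path of pairs of edges. A relation $R\subseteq X^+\times X^+$ is synchronously regular if $\delta_X(R)$ is a regular language (over the edges of $X^{\$}\times X^{\$}$). Automaticity. A choice of representatives for a semigroupoid $S$ is a triple $(X,K,\rho)$ where $X$ is a graph with $X^0=S^0$, $\rho:X^+\to S$ is a surjective semigroupoid morphism that is the identity on objects, and $K\subseteq X^+$ satisfies $\rho(K)=S^1$. It is finitely generated if $X$ has finitely many edges. An automatic structure for $S$ is a finitely generated choice of representatives $(X,K,\rho)$ such that the relation $K_a=\{(u,v)\in K\times K : \omega(u)=\alpha(a),\ \rho(ua)=\rho(v)\}$ is synchronously regular for each edge $a\in X^1$, and the relation $K_a=\{(u,v)\in K\times K: \omega(u)=a,\ \rho(u)=\rho(v)\}$ is synchronously regular for each vertex $a\in X^0$ (regarded as an empty path). A prefix-automatic structure is an automatic structure $(X,K,\rho)$ such that moreover $K'_= = \{(u,v)\in K\times \mathrm{Pref}(K): \rho(u)=\rho(v)\}$ is synchronously regular, where $\mathrm{Pref}(K)$ is the set of non-empty prefixes of paths in $K$. $S$ is prefix-automatic if it admits a prefix-automatic structure. Rees matrix semigroups. Let $S$ be a non-empty isolation-free semigroupoid, $I,\Lambda$ index sets, $F:I\to\alpha(S^1)$ and $G:\Lambda\to\omega(S^1)$ surjective functions, $0$ a new symbol not in $S$, and $P$ a $\Lambda\times I$ matrix with entries in $S\cup\{0\}$ such that $\alpha(P_{\lambda i})=G(\lambda)$ and $\omega(P_{\lambda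 i})=F(i)$ whenever $P_{\lambda i}\neq 0$. The Rees matrix semigroup with zero $M^0(S;F(I),G(\Lambda);P)$ (the notation $F(I),G(\Lambda)$ is purely symbolic) has elements $\{0\}\cup\{(i,x,\lambda)\in I\times S\times\Lambda : F(i)=\alpha(x),\ \omega(x)=G(\lambda)\}$, with $(i,x,\lambda)(j,y,\mu)=(i,xP_{\lambda j}y,\mu)$ if $P_{\lambda j}\ne 0$ and $=0$ otherwise, and $0m=m0=0$ for all $m$. Right-ideal-generation. A subset $T\subseteq S^1$ is weakly right-ideal-generated by a row cross-section of $P$ if there is a subset $\Lambda'\subseteq\Lambda$ such that $G$ restricts to a bijection $\Lambda'\to\omega(S^1)$ and every arrow in $T$ can be written in the form $P_{\lambda i}s$ or in the form $P_{\lambda i}$ for some $\lambda\in\Lambda'$, $i\in I$ (with $P_{\lambda i}\ne0$) and, where appropriate, $s\in S^1$. *)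

theory Defs
  imports "Graph_Theory.Graph_Theory" "HOL-Library.Sublist"
begin

section \<open>Semigroupoids\<close>

record ('o, 'a) pre_semigroupoid = "('o, 'a) pre_digraph" +
  mult :: "'a \<Rightarrow> 'a \<Rightarrow> 'a"

text \<open>Products are read from left to right: \<open>mult S e f\<close> is meaningful only if
  \<open>head S e = tail S f\<close>, and nothing is assumed about its value otherwise.\<close>

locale semigroupoid =
  fixes S :: "('o, 'a) pre_semigroupoid" (structure)
  assumes tail_in_objects: "e \<in> arcs S \<Longrightarrow> tail S e \<in> verts S"
    and head_in_objects: "e \<in> arcs S \<Longrightarrow> head S e \<in> verts S"
    and mult_closed:
      "\<lbrakk>e \<in> arcs S; f \<in> arcs S; head S e = tail S f\<rbrakk> \<Longrightarrow> mult S e f \<in> arcs S"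
    and tail_mult:
      "\<lbrakk>e \<in> arcs S; f \<in> arcs S; head S e = tail S f\<rbrakk> \<Longrightarrow> tail S (mult S e f) = tail S e"
    and head_mult:
      "\<lbrakk>e \<in> arcs S; f \<in> arcs S; head S e = tail S f\<rbrakk> \<Longrightarrow> head S (mult S e f) = head S f"
    and mult_assoc:
      "\<lbrakk>e \<in> arcs S; f \<in> arcs S; g \<in> arcs S; head S e = tail S f; head S f = tail S g\<rbrakk>
        \<Longrightarrow> mult S e (mult S f g) = mult S (mult S e f) g"

definition isolation_free :: "('o, 'a, 'z) pre_semigroupoid_scheme \<Rightarrow> bool" where
  "isolation_free S \<longleftrightarrow> (\<forall>v \<in> verts S. \<exists>a \<in> arcs S. tail S a = v \<or> head S a = v)"

definition identity_element :: "('o, 'a, 'z) pre_semigroupoid_scheme \<Rightarrow> 'a \<Rightarrow> bool" where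
  "identity_element S e \<longleftrightarrow>
     e \<in> arcs S \<and> tail S e = head S e \<and>
     (\<forall>s \<in> arcs S. head S e = tail S s \<longrightarrow> mult S e s = s) \<and>
     (\<forall>t \<in> arcs S. head S t = tail S e \<longrightarrow> mult S t e = t)"

definition semigroupoid_hom ::
  "('o, 'a) pre_semigroupoid \<Rightarrow> ('p, 'b) pre_semigroupoid \<Rightarrow> ('o \<Rightarrow> 'p) \<Rightarrow> ('a \<Rightarrow> 'b) \<Rightarrow> bool"
  where
  "semigroupoid_hom S T f g \<longleftrightarrow>
     f ` verts S \<subseteq> verts T \<and> g ` arcs S \<subseteq> arcs T \<and>
     (\<forall>a \<in> arcs S. tail T (g a) = f (tail S a) \<and> head T (g a) = f (head S a)) \<and>
     (\<forall>a \<in> arcs S. \<forall>b \<in> arcs S. head S a = tail S b \<longrightarrow> g (mult S a b) = mult T (g a) (g b))"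

inductive_set generated :: "('o, 'a) pre_semigroupoid \<Rightarrow> 'a set \<Rightarrow> 'a set"
  for S :: "('o, 'a) pre_semigroupoid" and A :: "'a set" where
  generated_incl: "a \<in> A \<Longrightarrow> a \<in> generated S A"
| generated_mult: "\<lbrakk>a \<in> generated S A; b \<in> generated S A; head S a = tail S b\<rbrakk>
    \<Longrightarrow> mult S a b \<in> generated S A"

definition finitely_generated :: "('o, 'a) pre_semigroupoid \<Rightarrow> bool" where
  "finitely_generated S \<longleftrightarrow> (\<exists>A \<subseteq> arcs S. finite A \<and> generated S A = arcs S)"


section \<open>Paths and regularity\<close>

definition paths :: "('v, 'e) pre_digraph \<Rightarrow> 'e list set" where
  "paths X = {p. p \<noteq> [] \<and> (\<exists>u v. pre_digraph.awalk X u p v)}"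

definition free_semigroupoid :: "('v, 'e) pre_digraph \<Rightarrow> ('v, 'e list) pre_semigroupoid" where
  "free_semigroupoid X =
     \<lparr>verts = verts X, arcs = paths X,
      tail = (\<lambda>p. tail X (hd p)), head = (\<lambda>p. head X (last p)), mult = (@)\<rparr>"

text \<open>Acceptance by a finite complete deterministic automaton over the alphabet \<open>A\<close>; taking
  natural numbers as states is no restriction.\<close>

definition regular :: "'e set \<Rightarrow> 'e list set \<Rightarrow> bool" where
  "regular A L \<longleftrightarrow>
     (\<exists>(Q :: nat set) q0 \<delta> F. finite Q \<and> q0 \<in> Q \<and> F \<subseteq> Q \<and>
        (\<forall>q \<in> Q. \<forall>a \<in> A. \<delta> q a \<in> Q) \<and>
        L = {w \<in> lists A. foldl \<delta> q0 w \<in> F})"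

text \<open>\<open>Inr v\<close> is the padding loop at the vertex \<open>v\<close>.\<close>

definition dollar_graph :: "('v, 'e) pre_digraph \<Rightarrow> ('v, 'e + 'v) pre_digraph" where
  "dollar_graph X =
     \<lparr>verts = verts X, arcs = Inl ` arcs X \<union> Inr ` verts X,
      tail = case_sum (tail X) id, head = case_sum (head X) id\<rparr>"

definition prod_graph ::
  "('v, 'e) pre_digraph \<Rightarrow> ('w, 'f) pre_digraph \<Rightarrow> ('v \<times> 'w, 'e \<times> 'f) pre_digraph" where
  "prod_graph X Y =
     \<lparr>verts = verts X \<times> verts Y, arcs = arcs X \<times> arcs Y,
      tail = map_prod (tail X) (tail Y), head = map_prod (head X) (head Y)\<rparr>"

definition pad :: "('v, 'e) pre_digraph \<Rightarrow> nat \<Rightarrow> 'e list \<Rightarrow> ('e + 'v) list" where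
  "pad X n p = map Inl p @ replicate (n - length p) (Inr (head X (last p)))"

definition delta ::
  "('v, 'e) pre_digraph \<Rightarrow> 'e list \<times> 'e list \<Rightarrow> (('e + 'v) \<times> ('e + 'v)) list" where
  "delta X = (\<lambda>(a, b). zip (pad X (length b) a) (pad X (length a) b))"

definition synchronously_regular ::
  "('v, 'e) pre_digraph \<Rightarrow> ('e list \<times> 'e list) set \<Rightarrow> bool" where
  "synchronously_regular X R \<longleftrightarrow>
     R \<subseteq> paths X \<times> paths X \<and>
     regular (arcs (prod_graph (dollar_graph X) (dollar_graph X))) (delta X ` R)"


section \<open>Automatic and prefix-automatic structures\<close>

definition choice_of_representatives ::
  "('o, 'a) pre_semigroupoid \<Rightarrow> ('o, 'e) pre_digraph \<Rightarrow> 'e list set \<Rightarrow> ('e list \<Rightarrow> 'a) \<Rightarrow> bool"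
  where
  "choice_of_representatives S X K \<rho> \<longleftrightarrow>
     wf_digraph X \<and> verts X = verts S \<and>
     semigroupoid_hom (free_semigroupoid X) S id \<rho> \<and> \<rho> ` paths X = arcs S \<and>
     K \<subseteq> paths X \<and> \<rho> ` K = arcs S"

definition rel_edge ::
  "('o, 'e) pre_digraph \<Rightarrow> 'e list set \<Rightarrow> ('e list \<Rightarrow> 'a) \<Rightarrow> 'e \<Rightarrow> ('e list \<times> 'e list) set" where
  "rel_edge X K \<rho> a =
     {(u, v). u \<in> K \<and> v \<in> K \<and> head X (last u) = tail X a \<and> \<rho> (u @ [a]) = \<rho> v}"

definition rel_vertex ::
  "('o, 'e) pre_digraph \<Rightarrow> 'e list set \<Rightarrow> ('e list \<Rightarrow> 'a) \<Rightarrow> 'o \<Rightarrow> ('e list \<times> 'e list) set" where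
  "rel_vertex X K \<rho> a = {(u, v). u \<in> K \<and> v \<in> K \<and> head X (last u) = a \<and> \<rho> u = \<rho> v}"

text \<open>Finiteness of the vertex set is part of \<open>fin_digraph\<close>: regularity is only considered over
  finite graphs. For an isolation-free semigroupoid it already follows from finiteness of the
  edge set.\<close>

definition automatic_structure ::
  "('o, 'a) pre_semigroupoid \<Rightarrow> ('o, 'e) pre_digraph \<Rightarrow> 'e list set \<Rightarrow> ('e list \<Rightarrow> 'a) \<Rightarrow> bool"
  where
  "automatic_structure S X K \<rho> \<longleftrightarrow>
     choice_of_representatives S X K \<rho> \<and> fin_digraph X \<and>
     (\<forall>a \<in> arcs X. synchronously_regular X (rel_edge X K \<rho> a)) \<and>
     (\<forall>a \<in> verts X. synchronously_regular X (rel_vertex X K \<rho> a))"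

definition Pref :: "'e list set \<Rightarrow> 'e list set" where
  "Pref K = {p. p \<noteq> [] \<and> (\<exists>w \<in> K. prefix p w)}"

definition rel_prefix ::
  "'e list set \<Rightarrow> ('e list \<Rightarrow> 'a) \<Rightarrow> ('e list \<times> 'e list) set" where
  "rel_prefix K \<rho> = {(u, v). u \<in> K \<and> v \<in> Pref K \<and> \<rho> u = \<rho> v}"

definition prefix_automatic_structure ::
  "('o, 'a) pre_semigroupoid \<Rightarrow> ('o, 'e) pre_digraph \<Rightarrow> 'e list set \<Rightarrow> ('e list \<Rightarrow> 'a) \<Rightarrow> bool"
  where
  "prefix_automatic_structure S X K \<rho> \<longleftrightarrow>
     automatic_structure S X K \<rho> \<and> synchronously_regular X (rel_prefix K \<rho>)"

text \<open>The edges of \<open>X\<close> are named by natural numbers. This is no restriction, since \<open>X\<close> has only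
  finitely many edges.\<close>

definition prefix_automatic :: "('o, 'a) pre_semigroupoid \<Rightarrow> bool" where
  "prefix_automatic S \<longleftrightarrow>
     (\<exists>(X :: ('o, nat) pre_digraph) K \<rho>. prefix_automatic_structure S X K \<rho>)"


section \<open>Rees matrix semigroups with zero\<close>

text \<open>The matrix entry \<open>None\<close> and the semigroup element \<open>None\<close> both stand for the zero.\<close>

locale rees_matrix_data = semigroupoid S
  for S :: "('o, 'a) pre_semigroupoid" (structure) +
  fixes I :: "'i set" and \<Lambda> :: "'l set"
    and F :: "'i \<Rightarrow> 'o" and G :: "'l \<Rightarrow> 'o"
    and P :: "'l \<Rightarrow> 'i \<Rightarrow> 'a option"
  assumes nonempty: "arcs S \<noteq> {}"
    and isolation_free: "isolation_free S"
    and F_surj: "F ` I = tail S ` arcs S"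
    and G_surj: "G ` \<Lambda> = head S ` arcs S"
    and P_entry: "\<lbrakk>l \<in> \<Lambda>; i \<in> I; P l i = Some p\<rbrakk>
      \<Longrightarrow> p \<in> arcs S \<and> tail S p = G l \<and> head S p = F i"

fun rees_mult ::
  "('o, 'a) pre_semigroupoid \<Rightarrow> ('l \<Rightarrow> 'i \<Rightarrow> 'a option) \<Rightarrow>
   ('i \<times> 'a \<times> 'l) option \<Rightarrow> ('i \<times> 'a \<times> 'l) option \<Rightarrow> ('i \<times> 'a \<times> 'l) option" where
  "rees_mult S P (Some (i, x, l)) (Some (j, y, m)) =
     (case P l j of
        None \<Rightarrow> None
      | Some p \<Rightarrow> Some (i, mult S (mult S x p) y, m))"
| "rees_mult S P _ _ = None"

text \<open>A semigroup is regarded as a semigroupoid with the single object \<open>()\<close>.\<close>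

definition rees_matrix_semigroup ::
  "('o, 'a) pre_semigroupoid \<Rightarrow> 'i set \<Rightarrow> 'l set \<Rightarrow> ('i \<Rightarrow> 'o) \<Rightarrow> ('l \<Rightarrow> 'o) \<Rightarrow>
   ('l \<Rightarrow> 'i \<Rightarrow> 'a option) \<Rightarrow> (unit, ('i \<times> 'a \<times> 'l) option) pre_semigroupoid" where
  "rees_matrix_semigroup S I \<Lambda> F G P =
     \<lparr>verts = {()},
      arcs = insert None
        {Some (i, x, l) | i x l. i \<in> I \<and> x \<in> arcs S \<and> l \<in> \<Lambda> \<and> F i = tail S x \<and> head S x = G l},
      tail = (\<lambda>_. ()), head = (\<lambda>_. ()), mult = rees_mult S P\<rparr>"

definition weakly_right_ideal_generated ::
  "('o, 'a) pre_semigroupoid \<Rightarrow> 'i set \<Rightarrow> 'l set \<Rightarrow> ('l \<Rightarrow> 'o) \<Rightarrow>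
   ('l \<Rightarrow> 'i \<Rightarrow> 'a option) \<Rightarrow> 'a set \<Rightarrow> bool" where
  "weakly_right_ideal_generated S I \<Lambda> G P T \<longleftrightarrow>
     (\<exists>\<Lambda>' \<subseteq> \<Lambda>. bij_betw G \<Lambda>' (head S ` arcs S) \<and>
        (\<forall>t \<in> T. \<exists>l \<in> \<Lambda>'. \<exists>i \<in> I. \<exists>p. P l i = Some p \<and>
           (t = p \<or> (\<exists>s \<in> arcs S. head S p = tail S s \<and> t = mult S p s))))"


section \<open>Well-formedness of the constructions\<close>

lemma paths_append:
  assumes "wf_digraph X" "p \<in> paths X" "q \<in> paths X" "head X (last p) = tail X (hd q)"
  shows "p @ q \<in> paths X"
proof -
  interpret wf_digraph X by fact
  obtain u v where p: "awalk u p v" "p \<noteq> []" using assms(2) by (auto simp: paths_def)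
  obtain u' v' where q: "awalk u' q v'" "q \<noteq> []" using assms(3) by (auto simp: paths_def)
  have "v = head X (last p)" using p
    by (induction p arbitrary: u) (auto simp: awalk_Cons_iff awalk_Nil_iff split: if_splits)
  moreover have "u' = tail X (hd q)" using q by (cases q) (auto simp: awalk_Cons_iff)
  ultimately have "awalk u (p @ q) v'" using p q assms(4) by (auto simp: awalk_append_iff awlast_if_cas awalk_def)
  then show ?thesis using p by (auto simp: paths_def simp del: awalk_append_iff)
qed

lemma semigroupoid_free_semigroupoid:
  assumes "wf_digraph X"
  shows "semigroupoid (free_semigroupoid X)"
proof -
  interpret wf_digraph X by fact
  have ne: "p \<noteq> []" and sub: "set p \<subseteq> arcs X" if "p \<in> paths X" for p
    using that by (auto simp: paths_def awalk_def)
  have "hd p \<in> arcs X" "last p \<in> arcs X" if "p \<in> paths X" for p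
    using ne[OF that] sub[OF that] by auto
  then show ?thesis
    by unfold_locales
      (auto simp: free_semigroupoid_def paths_append[OF assms] ne hd_append last_append)
qed

lemma (in rees_matrix_data) semigroupoid_rees_matrix_semigroup:
  "semigroupoid (rees_matrix_semigroup S I \<Lambda> F G P)"
proof unfold_locales
  fix a b c
  let ?M = "rees_matrix_semigroup S I \<Lambda> F G P"
  assume a: "a \<in> arcs ?M" and b: "b \<in> arcs ?M"
  show "mult ?M a b \<in> arcs ?M"
    using a b P_entry
    by (fastforce simp: rees_matrix_semigroup_def mult_closed tail_mult head_mult
        split: option.splits)
  assume c: "c \<in> arcs ?M"
  show "mult ?M a (mult ?M b c) = mult ?M (mult ?M a b) c"
  proof (cases "a = None \<or> b = None \<or> c = None")
    case True
    then show ?thesis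
      by (cases a; cases b; cases c) (auto simp: rees_matrix_semigroup_def split: option.splits)
  next
    case False
    then obtain i x l j y m k z n where abc:
      "a = Some (i, x, l)" "b = Some (j, y, m)" "c = Some (k, z, n)" by auto
    note in_M = a[unfolded abc] b[unfolded abc] c[unfolded abc]
    show ?thesis
      using in_M P_entry[of l j] P_entry[of m k] unfolding abc
      by (auto simp: rees_matrix_semigroup_def mult_assoc mult_closed tail_mult head_mult
          split: option.splits)
  qed
qed (auto simp: rees_matrix_semigroup_def)

end

theory Submission
  imports Defs
begin

text \<open>Let \<open>(X, K, \<rho>)\<close> be a prefix-automatic structure for \<open>S\<close>. A non-identity arrow times any arrow has
  the form \<open>P\<^bsub>\<lambda>j\<^esub>s\<close> with \<open>\<lambda>\<close> in the row cross-section, and by pumping every arrow has a representative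
  in \<open>K\<close> without long runs of identities, so that all its factors of a fixed length \<open>C\<close> have values of
  this form. Cutting such a representative into a first block of length at most \<open>C\<close> and further
  blocks of length \<open>C\<close> writes \<open>(i, x, \<lambda>)\<close> as \<open>(i, x\<^sub>1, \<lambda>\<^sub>1)(j\<^sub>2, s\<^sub>2, \<lambda>\<^sub>2)\<dots>(j\<^sub>n, s\<^sub>n, \<lambda>)\<close>, where
  \<open>P\<close> at row \<open>\<lambda>\<^sub>k\<close> and column \<open>j\<^sub>k\<^sub>+\<^sub>1\<close> times \<open>s\<^sub>k\<^sub>+\<^sub>1\<close> is the value of block \<open>k + 1\<close>. The blocks,
  labelled with \<open>i\<close> and \<open>\<lambda>\<close> at the ends, are the new generators. The relations to be checked are
  preimages under the decoding of blocks of relations known to be synchronously regular; the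
  multiplication by an arrow \<open>t\<close> of \<open>S\<close> is the composition of the multiplications by the letters
  of a path representing \<open>t\<close>. Regularity is handled through finiteness of the set of left
  quotients, with a version for pairs of words.\<close>

section \<open>Recognizable languages and synchronous relations\<close>

definition lquot :: "'e list set \<Rightarrow> 'e list \<Rightarrow> 'e list set" where
  "lquot L w = {z. w @ z \<in> L}"

text \<open>The Myhill-Nerode form of regularity: the left quotients are the states of the minimal
  automaton. No alphabet or automaton has to be carried along.\<close>

definition recognizable :: "'e list set \<Rightarrow> bool" where
  "recognizable L \<longleftrightarrow> finite (range (lquot L))"

text \<open>In a synchronous reading of two words, a word that has ended before the other is only followed
  by padding, so the continuations of a pair of unequal lengths extend at most the longer word.\<close>

definition ended :: "'e list \<Rightarrow> 'f list \<Rightarrow> ('e list \<times> 'f list) set" where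
  "ended u v = {(x, y). (length u < length v \<longrightarrow> x = []) \<and> (length v < length u \<longrightarrow> y = [])}"

definition res :: "('e list \<times> 'f list) set \<Rightarrow> 'e list \<times> 'f list \<Rightarrow> ('e list \<times> 'f list) set" where
  "res R = (\<lambda>(u, v). {(x, y). (u @ x, v @ y) \<in> R} \<inter> ended u v)"

text \<open>The Myhill-Nerode condition for pairs. Without \<open>ended\<close> even equality would
  fail it, having distinct residuals at the pairs \<open>([], v)\<close>.\<close>

definition synchronous :: "('e list \<times> 'f list) set \<Rightarrow> bool" where
  "synchronous R \<longleftrightarrow> finite (range (res R))"

text \<open>The default \<open>d\<close> is for arguments not accounted for by \<open>A\<close>,
  typically words without any continuation, whose quotient is empty.\<close>

lemma finite_range_factor:
  assumes "finite (f ` A)" "\<And>x. h x = d \<or> (\<exists>y\<in>A. h x = g (f y))"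
  shows "finite (range h)"
proof -
  have "range h \<subseteq> insert d (g ` f ` A)" using assms(2) by blast
  then show ?thesis using assms(1) finite_subset by blast
qed

text \<open>Only the comparison of the two lengths matters, which leaves three possible
  sets.\<close>

lemma finite_range_ended: "finite (range (\<lambda>(u :: 'a list, v :: 'b list). ended u v))"
proof -
  have "range (\<lambda>(u :: 'a list, v :: 'b list). ended u v) \<subseteq> {UNIV, {(x, y). x = []}, {(x, y). y = []}}"
  proof (rule image_subsetI)
    show "(\<lambda>(u, v). ended u v) w \<in> {UNIV, {(x, y). x = []}, {(x, y). y = []}}"
      for w :: "'a list \<times> 'b list"
      by (cases w; cases "length (fst w)" "length (snd w)" rule: linorder_cases)
        (auto simp: ended_def)
  qed
  then show ?thesis by (rule finite_subset) simp
qed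

lemma finite_range_pair:
  assumes "finite (range f)" "finite (range g)"
  shows "finite (range (\<lambda>x. (f x, g x)))"
  by (rule finite_subset[of _ "range f \<times> range g"]) (use assms in auto)

lemma finite_range_map_prod:
  assumes "finite (range f)" "finite (range g)"
  shows "finite (range (\<lambda>(x, y). (f x, g y)))"
  by (rule finite_subset[of _ "range f \<times> range g"]) (use assms in auto)

lemma recognizable_factor:
  assumes "finite (range f)" "\<And>w. lquot L w = g (f w)"
  shows "recognizable L"
  unfolding recognizable_def using assms finite_range_factor[of f UNIV "lquot L" "{}" g] by blast

lemma synchronous_factor:
  assumes "finite (range f)" "\<And>w. res R w = g (f w)"
  shows "synchronous R"
  unfolding synchronous_def using assms finite_range_factor[of f UNIV "res R" "{}" g] by blast

section \<open>Closure properties of recognizable languages\<close>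

lemma recognizable_empty [simp]: "recognizable {}"
  by (simp add: recognizable_def lquot_def)

lemma recognizable_Int:
  assumes "recognizable A" "recognizable B"
  shows "recognizable (A \<inter> B)"
  by (rule recognizable_factor[OF finite_range_pair[OF assms[unfolded recognizable_def]],
        where g = "\<lambda>(a, b). a \<inter> b"])
    (auto simp: lquot_def)

lemma recognizable_Un:
  assumes "recognizable A" "recognizable B"
  shows "recognizable (A \<union> B)"
  by (rule recognizable_factor[OF finite_range_pair[OF assms[unfolded recognizable_def]],
        where g = "\<lambda>(a, b). a \<union> b"])
    (auto simp: lquot_def)

lemma recognizable_UN:
  assumes "finite J" "\<And>j. j \<in> J \<Longrightarrow> recognizable (A j)"
  shows "recognizable (\<Union>j\<in>J. A j)"
  using assms by (induction J rule: finite_induct) (auto intro: recognizable_Un)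

text \<open>Here \<open>f w\<close> acts as the state reached after \<open>w\<close>, and
  \<open>g\<close> tells which continuations that state accepts.\<close>

lemma recognizable_bool:
  assumes "finite (range f)" "\<And>w z. w @ z \<in> L \<longleftrightarrow> g (f w) z"
  shows "recognizable L"
  by (rule recognizable_factor[OF assms(1), where g = "\<lambda>q. {z. g q z}"])
    (use assms(2) in \<open>auto simp: lquot_def\<close>)

lemma finite_range_bool [simp]: "finite (range (f :: _ \<Rightarrow> bool))"
  by (rule finite_subset[of _ UNIV]) auto

lemma recognizable_lists: "recognizable {x. set x \<subseteq> A}"
  by (rule recognizable_bool[of "\<lambda>w. set w \<subseteq> A" _ "\<lambda>q z. q \<and> set z \<subseteq> A"]) auto

lemma recognizable_hd: "recognizable {x. x \<noteq> [] \<and> hd x \<in> A}"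
  by (rule recognizable_bool[OF finite_range_pair[of "\<lambda>w. w = []" "\<lambda>w. hd w \<in> A"],
        where g = "\<lambda>(e, q) z. if e then z \<noteq> [] \<and> hd z \<in> A else q"])
    (auto simp: hd_append)

lemma recognizable_last: "recognizable {x. x \<noteq> [] \<and> last x \<in> A}"
  by (rule recognizable_bool[of "\<lambda>w. w \<noteq> [] \<and> last w \<in> A" _
        "\<lambda>q z. if z = [] then q else last z \<in> A"])
    (auto simp: last_append)

lemma recognizable_tl: "recognizable {x. set (tl x) \<subseteq> A}"
  by (rule recognizable_bool[OF finite_range_pair[of "\<lambda>w. w = []" "\<lambda>w. set (tl w) \<subseteq> A"],
        where g = "\<lambda>(e, q) z. if e then set (tl z) \<subseteq> A else q \<and> set z \<subseteq> A"])
    auto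

lemma recognizable_butlast: "recognizable {x. set (butlast x) \<subseteq> A}"
  by (rule recognizable_bool[OF finite_range_pair[of "\<lambda>w. set w \<subseteq> A" "\<lambda>w. set (butlast w) \<subseteq> A"],
        where g = "\<lambda>(e, q) z. if z = [] then q else e \<and> set (butlast z) \<subseteq> A"])
    (auto simp: butlast_append)

lemma recognizable_singleton: "recognizable {[a]}"
proof -
  have *: "{[a]} = {x. x \<noteq> [] \<and> hd x \<in> {a}} \<inter> {x. set (tl x) \<subseteq> {}}" (is "_ = ?A")
  proof (rule set_eqI)
    show "x \<in> {[a]} \<longleftrightarrow> x \<in> ?A" for x by (cases x) auto
  qed
  show ?thesis unfolding * by (intro recognizable_Int recognizable_hd recognizable_tl)
qed

text \<open>The left quotient of \<open>K\<close> determines that of \<open>Pref K\<close>, up to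
  the excluded empty word, which the flag \<open>w = []\<close> takes care of.\<close>

lemma recognizable_Pref:
  assumes "recognizable K"
  shows "recognizable (Pref K)"
proof (rule recognizable_bool[OF finite_range_pair[of "\<lambda>w. w = []" "lquot K"]])
  fix w z
  show "w @ z \<in> Pref K \<longleftrightarrow> (\<lambda>(e, Q) z. (\<not> (e \<and> z = [])) \<and> (\<exists>t. z @ t \<in> Q)) (w = [], lquot K w) z"
    by (auto simp: Pref_def lquot_def prefix_def)
qed (use assms in \<open>simp_all add: recognizable_def\<close>)

lemma recognizable_vimage_concat:
  assumes "recognizable L"
  shows "recognizable {x. concat (map f x) \<in> L}"
proof (rule recognizable_factor[of "\<lambda>x. lquot L (concat (map f x))"])
  show "finite (range (\<lambda>x. lquot L (concat (map f x))))"
    using assms unfolding recognizable_def by (rule rev_finite_subset) auto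
  show "lquot {x. concat (map f x) \<in> L} w =
      (\<lambda>Q. {z. concat (map f z) \<in> Q}) (lquot L (concat (map f w)))" for w
    by (simp add: lquot_def)
qed

section \<open>Closure properties of synchronous relations\<close>

lemma synchronous_empty [simp]: "synchronous {}"
  by (simp add: synchronous_def res_def case_prod_unfold)

lemma synchronous_Un:
  assumes "synchronous R" "synchronous T"
  shows "synchronous (R \<union> T)"
  by (rule synchronous_factor[OF finite_range_pair[OF assms[unfolded synchronous_def]],
        where g = "\<lambda>(a, b). a \<union> b"])
    (auto simp: res_def)

lemma synchronous_UN:
  assumes "finite J" "\<And>j. j \<in> J \<Longrightarrow> synchronous (R j)"
  shows "synchronous (\<Union>j\<in>J. R j)"
  using assms by (induction J rule: finite_induct) (auto intro: synchronous_Un)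

lemma synchronous_Int:
  assumes "synchronous R" "synchronous T"
  shows "synchronous (R \<inter> T)"
  by (rule synchronous_factor[OF finite_range_pair[OF assms[unfolded synchronous_def]],
        where g = "\<lambda>(a, b). a \<inter> b"])
    (auto simp: res_def)

lemma synchronous_Times:
  assumes "recognizable A" "recognizable B"
  shows "synchronous (A \<times> B)"
  by (rule synchronous_factor[OF finite_range_pair[OF
          finite_range_map_prod[OF assms[unfolded recognizable_def]] finite_range_ended],
        where g = "\<lambda>((a, b), c). (a \<times> b) \<inter> c"])
    (auto simp: res_def lquot_def)

text \<open>Two equal words always have equal lengths, so \<open>ended\<close> imposes nothing. This
  extracts the regularity of \<open>K\<close> from that of its equality relation.\<close>

lemma recognizable_diagonal:
  assumes "synchronous R"
  shows "recognizable {w. (w, w) \<in> R}"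
proof (rule recognizable_factor[of "\<lambda>w. res R (w, w)"])
  show "finite (range (\<lambda>x. res R (x, x)))"
    using assms unfolding synchronous_def by (rule rev_finite_subset) auto
  show "lquot {w. (w, w) \<in> R} w = (\<lambda>Q. {z. (z, z) \<in> Q}) (res R (w, w))" for w
    by (simp add: lquot_def res_def ended_def)
qed

text \<open>Subset construction: the middle word is guessed, and the state is the set of pairs of
  residuals over all guesses, of which there are finitely many.\<close>

lemma synchronous_relcomp:
  assumes "synchronous R" "synchronous T"
  shows "synchronous (R O T)"
proof (rule synchronous_factor)
  let ?m = "\<lambda>(u, v). {(res R (u, m), res T (m, v)) | m. length m \<le> max (length u) (length v)}"
  show "finite (range (\<lambda>w. (?m w, (\<lambda>(u, v). ended u v) w)))"
  proof (rule finite_range_pair[OF _ finite_range_ended])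
    have "finite (Pow (range (res R) \<times> range (res T)))"
      using assms by (simp add: synchronous_def)
    then show "finite (range ?m)" by (rule rev_finite_subset) auto
  qed
  show "res (R O T) w = (\<lambda>(Q, c). (\<Union>(A, B)\<in>Q. A O B) \<inter> c) (?m w, (\<lambda>(u, v). ended u v) w)" for w
  proof (cases w)
    case (Pair u v)
    have "res (R O T) (u, v) = (\<Union>(A, B)\<in>?m (u, v). A O B) \<inter> ended u v"
    proof (intro equalityI subrelI)
      fix x y assume xy: "(x, y) \<in> res (R O T) (u, v)"
      then obtain k where k: "(u @ x, k) \<in> R" "(k, v @ y) \<in> T" by (auto simp: res_def)
      \<comment> \<open>Cutting the middle word at the longer of the two lengths respects
        \<open>ended\<close> on both sides: any of the three words that stops before position
        \<open>n\<close> has an empty continuation.\<close>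
      define n where "n = max (length u) (length v)"
      have end_xy: "(x, y) \<in> ended u v" using xy by (simp add: res_def)
      have "(x, drop n k) \<in> res R (u, take n k)" "(drop n k, y) \<in> res T (take n k, v)"
        using k end_xy by (auto simp: res_def ended_def n_def max_def split: if_splits)
      moreover have "length (take n k) \<le> max (length u) (length v)" by (simp add: n_def)
      ultimately show "(x, y) \<in> (\<Union>(A, B)\<in>?m (u, v). A O B) \<inter> ended u v"
        using end_xy by fast
    next
      fix x y assume "(x, y) \<in> (\<Union>(A, B)\<in>?m (u, v). A O B) \<inter> ended u v"
      then obtain m k where "(x, k) \<in> res R (u, m)" "(k, y) \<in> res T (m, v)" "(x, y) \<in> ended u v"
        by auto
      then show "(x, y) \<in> res (R O T) (u, v)" by (auto simp: res_def)
    qed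
    then show ?thesis using Pair by simp
  qed
qed

text \<open>The bounds on the lengths of the blocks keep the two decoded words, read in parallel, less
  than \<open>C\<close> letters apart, so that a bounded buffer suffices to read them synchronously.\<close>

lemma synchronous_vimage_blocks:
  fixes f :: "'x \<Rightarrow> 'e list"
  assumes R: "synchronous R" and fin: "finite (\<Union>a\<in>A. set (f a))"
    and first: "\<And>a. a \<in> A \<Longrightarrow> 0 < length (f a) \<and> length (f a) \<le> C"
    and B: "B \<subseteq> A" "\<And>a. a \<in> B \<Longrightarrow> length (f a) = C"
  shows "synchronous {(x, y). set x \<subseteq> A \<and> set (tl x) \<subseteq> B \<and> set y \<subseteq> A \<and> set (tl y) \<subseteq> B \<and>
           (concat (map f x), concat (map f y)) \<in> R}"
    (is "synchronous ?R")
proof -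
  define D where "D x = concat (map f x)" for x
  define W where "W = {x. set x \<subseteq> A} \<inter> {x. set (tl x) \<subseteq> B}"
  define Z where "Z = (\<Union>a\<in>A. set (f a))"
  define buf where "buf = {w. set w \<subseteq> Z \<and> length w \<le> C}"
  have D_app: "D (x @ y) = D x @ D y" for x y by (simp add: D_def)
  have W: "recognizable W"
    unfolding W_def by (intro recognizable_Int recognizable_lists recognizable_tl)
  have W_prefix: "x \<in> W" if "x @ y \<in> W" for x y
    using that by (cases x) (auto simp: W_def)
  \<comment> \<open>All blocks after the first have length exactly \<open>C\<close>, and the first
    has length between 1 and \<open>C\<close>.\<close>
  have len: "length (D x) \<le> length x * C" "x \<noteq> [] \<Longrightarrow> (length x - 1) * C < length (D x)"
    if "x \<in> W" for x
  proof -
    have "length (D y) = length y * C" if "set y \<subseteq> B" for y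
      using that B(2) by (induction y) (auto simp: D_def)
    then show "length (D x) \<le> length x * C" "x \<noteq> [] \<Longrightarrow> (length x - 1) * C < length (D x)"
      using \<open>x \<in> W\<close> first by (cases x; force simp: D_def W_def)+
  qed
  have len_less: "length (D x) < length (D y)" if "x \<in> W" "y \<in> W" "length x < length y" for x y
  proof -
    have "length (D x) \<le> length x * C" using len that by blast
    also have "\<dots> \<le> (length y - 1) * C" using that by (intro mult_right_mono) auto
    also have "\<dots> < length (D y)" using len(2)[of y] that by force
    finally show ?thesis .
  qed
  have len_eq: "length (D x) \<le> length (D y) + C" if "x \<in> W" "y \<in> W" "length x = length y" for x y
  proof (cases "y = []")
    case False
    have "length (D x) \<le> length x * C" using len that by blast
    also have "length x * C = (length y - 1) * C + C"
      using that False by (cases "length y") auto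
    also have "\<dots> \<le> length (D y) + C" using len(2)[OF that(2) False] by simp
    finally show ?thesis .
  qed (use that in \<open>auto simp: D_def\<close>)
  have D_Z: "set (D x) \<subseteq> Z" if "x \<in> W" for x
    using that by (auto simp: D_def Z_def W_def)
  have fin_buf: "finite buf"
    unfolding buf_def by (rule finite_lists_length_le) (use fin in \<open>simp add: Z_def\<close>)
  \<comment> \<open>With equally many letters, both decodings are read up to the shorter one and the
    surplus of the other, at most \<open>C\<close> letters, is buffered. Otherwise one word has
    ended, so both decodings are read completely and the buffers are empty.\<close>
  define n where "n = (\<lambda>(x, y). if length x = length y then min (length (D x)) (length (D y))
     else max (length (D x)) (length (D y)))"
  define st where "st = (\<lambda>(x, y). (res R (take (n (x, y)) (D x), take (n (x, y)) (D y)),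
     drop (n (x, y)) (D x), drop (n (x, y)) (D y), lquot W x, lquot W y, ended x y))"
  define g where "g = (\<lambda>(Q, a, b, V, V', c).
     {(x', y'). (a @ D x', b @ D y') \<in> Q \<and> x' \<in> V \<and> y' \<in> V'} \<inter> c)"
  let ?E = "range (res R) \<times> buf \<times> buf \<times> range (lquot W) \<times> range (lquot W) \<times>
    range (\<lambda>(u :: 'x list, v :: 'x list). ended u v)"
  have "finite (st ` (W \<times> W))"
  proof (rule finite_subset)
    show "st ` (W \<times> W) \<subseteq> ?E"
    proof (rule image_subsetI)
      fix w assume "w \<in> W \<times> W"
      then obtain x y where w: "w = (x, y)" and xy: "x \<in> W" "y \<in> W" by blast
      have "drop (n (x, y)) (D x) \<in> buf" "drop (n (x, y)) (D y) \<in> buf"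
        using D_Z[OF xy(1)] D_Z[OF xy(2)] len_eq[OF xy] len_eq[OF xy(2,1)]
        by (auto simp: buf_def n_def max_def min_def dest: in_set_dropD)
      then show "st w \<in> ?E" by (auto simp: st_def w)
    qed
    show "finite (?E)"
      using R W fin_buf finite_range_ended
      unfolding synchronous_def recognizable_def by (intro finite_cartesian_product)
  qed
  moreover have "res ?R w = {} \<or> (\<exists>w'\<in>W \<times> W. res ?R w = g (st w'))" for w
  proof (cases w)
    case (Pair x y)
    show ?thesis
    proof (cases "x \<in> W \<and> y \<in> W")
      case False
      have "x \<in> W \<and> y \<in> W" if "(x @ x', y @ y') \<in> ?R" for x' y'
        using that W_prefix[of x x'] W_prefix[of y y'] by (simp add: W_def)
      then have "res ?R w = {}" using False Pair by (auto simp: res_def)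
      then show ?thesis ..
    next
      case True
      have D_drop: "take k (D x) @ drop k (D x) @ D x' = D (x @ x')" for k x x'
        by (simp add: D_app flip: append_assoc)
      have "(x', y') \<in> res ?R (x, y) \<longleftrightarrow> (x', y') \<in> g (st (x, y))" for x' y'
      proof -
        define k where "k = n (x, y)"
        \<comment> \<open>If one word has ended, \<open>len_less\<close> makes its decoding the
          shorter one, and nothing follows it. For equal lengths both decodings were cut to the same
          length.\<close>
        have "(drop k (D x) @ D x', drop k (D y) @ D y') \<in> ended (take k (D x)) (take k (D y))"
          if "(x', y') \<in> ended x y"
          using that True len_less[of x y] len_less[of y x]
          by (cases "length x" "length y" rule: linorder_cases)
            (auto simp: ended_def k_def n_def D_def[of "[]"])
        then show ?thesis
          by (auto simp: res_def g_def st_def k_def[symmetric] D_drop W_def lquot_def D_def[symmetric])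
      qed
      then have "res ?R w = g (st w)" unfolding Pair by auto
      then show ?thesis using True Pair by blast
    qed
  qed
  ultimately show ?thesis
    unfolding synchronous_def by (rule finite_range_factor)
qed

section \<open>Regular and recognizable languages agree\<close>

lemma regular_imp_recognizable:
  assumes "regular A L"
  shows "recognizable L"
proof -
  obtain Q :: "nat set" and q0 \<delta> T where Q: "finite Q" "q0 \<in> Q" "\<And>q a. q \<in> Q \<Longrightarrow> a \<in> A \<Longrightarrow> \<delta> q a \<in> Q"
    and L: "L = {w \<in> lists A. foldl \<delta> q0 w \<in> T}"
    using assms unfolding regular_def by blast
  have run: "foldl \<delta> q w \<in> Q" if "w \<in> lists A" "q \<in> Q" for w q
    using that by (induction w arbitrary: q) (auto simp: Q)
  have "lquot L w = {} \<or> (\<exists>q\<in>Q. lquot L w = {z \<in> lists A. foldl \<delta> q z \<in> T})" for w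
  proof (cases "w \<in> lists A")
    case True
    then have "lquot L w = {z \<in> lists A. foldl \<delta> (foldl \<delta> q0 w) z \<in> T}"
      by (auto simp: lquot_def L)
    then show ?thesis using run[OF True Q(2)] by blast
  qed (auto simp: lquot_def L)
  then show ?thesis
    unfolding recognizable_def using Q(1)
    by (intro finite_range_factor[of id Q "lquot L" "{}" "\<lambda>q. {z \<in> lists A. foldl \<delta> q z \<in> T}"]) simp_all
qed

text \<open>The left quotients serve as states, transported along an injection into the natural
  numbers because \<open>regular\<close> takes its states there.\<close>

lemma recognizable_imp_regular:
  assumes "recognizable L" "L \<subseteq> lists A"
  shows "regular A L"
proof -
  obtain enc :: "_ \<Rightarrow> nat" where enc: "inj_on enc (range (lquot L))"
    using finite_imp_inj_to_nat_seg[of "range (lquot L)"] assms(1)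
    by (auto simp: recognizable_def)
  define dec where "dec = inv_into (range (lquot L)) enc"
  have dec: "dec (enc (lquot L w)) = lquot L w" for w
    unfolding dec_def using enc by (rule inv_into_f_f) simp
  define \<delta> where "\<delta> q a = enc (lquot (dec q) [a])" for q a
  have step: "\<delta> (enc (lquot L w)) a = enc (lquot L (w @ [a]))" for w a
    unfolding \<delta>_def dec by (simp add: lquot_def)
  have run: "foldl \<delta> (enc (lquot L w)) z = enc (lquot L (w @ z))" for w z
    by (induction z arbitrary: w) (simp_all add: step)
  have "enc (lquot L w) \<in> enc ` {Y \<in> range (lquot L). [] \<in> Y} \<longleftrightarrow> [] \<in> lquot L w" for w
    by (subst inj_on_image_mem_iff[OF enc]) auto
  then have "enc (lquot L w) \<in> enc ` {Y \<in> range (lquot L). [] \<in> Y} \<longleftrightarrow> w \<in> L" for w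
    by (simp add: lquot_def)
  then have L: "L = {w \<in> lists A. foldl \<delta> (enc (lquot L [])) w \<in> enc ` {Y \<in> range (lquot L). [] \<in> Y}}"
    unfolding run using assms(2) by auto
  have fin: "finite (enc ` range (lquot L))" using assms(1) by (simp add: recognizable_def)
  have closed: "\<forall>q \<in> enc ` range (lquot L). \<forall>a \<in> A. \<delta> q a \<in> enc ` range (lquot L)"
    using step by auto
  have start: "enc (lquot L []) \<in> enc ` range (lquot L)" by simp
  have final: "enc ` {Y \<in> range (lquot L). [] \<in> Y} \<subseteq> enc ` range (lquot L)" by auto
  show ?thesis
    unfolding regular_def
    by (rule exI[of _ "enc ` range (lquot L)"], rule exI[of _ "enc (lquot L [])"],
        rule exI[of _ \<delta>], rule exI[of _ "enc ` {Y \<in> range (lquot L). [] \<in> Y}"])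
      (intro conjI fin start final closed L)
qed

section \<open>Padded readings and synchronous regularity\<close>

definition unpad :: "(('e + 'v) \<times> ('f + 'w)) list \<Rightarrow> 'e list \<times> 'f list" where
  "unpad w = (map projl (filter isl (map fst w)), map projl (filter isl (map snd w)))"

lemma unpad_append: "unpad (w @ z) = (fst (unpad w) @ fst (unpad z), snd (unpad w) @ snd (unpad z))"
  by (simp add: unpad_def)

lemma length_pad: "length (pad X n p) = max n (length p)"
  by (simp add: pad_def)

lemma map_fst_delta: "map fst (delta X (a, b)) = pad X (length b) a"
  and map_snd_delta: "map snd (delta X (a, b)) = pad X (length a) b"
  by (simp_all add: delta_def length_pad max.commute)

lemma projl_pad: "map projl (filter isl (pad X n p)) = p"
  by (simp add: pad_def comp_def)

lemma unpad_delta: "unpad (delta X (a, b)) = (a, b)"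
  by (simp add: unpad_def map_fst_delta map_snd_delta projl_pad)

lemma length_delta: "length (delta X (a, b)) = max (length a) (length b)"
  by (simp add: delta_def length_pad max.commute)

text \<open>The shorter of \<open>u\<close> and \<open>v\<close> is not continued, so its last
  letter and hence its padding loop stay the same.\<close>

lemma delta_append:
  assumes "(x, y) \<in> ended u v"
  shows "delta X (u @ x, v @ y) = delta X (u, v) @
    zip (map Inl x @ replicate (length y - length x) (Inr (head X (last (u @ x)))))
        (map Inl y @ replicate (length x - length y) (Inr (head X (last (v @ y)))))"
proof (cases "length u" "length v" rule: linorder_cases)
  case less
  have "replicate (length v + length y - length u) c =
      replicate (length v - length u) c @ replicate (length y) c" for c :: 'z
    using less by (simp flip: replicate_add)
  then show ?thesis using less assms by (simp add: delta_def pad_def ended_def zip_append2)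
next
  case equal
  then show ?thesis by (simp add: delta_def pad_def)
next
  case greater
  have "replicate (length u + length x - length v) c =
      replicate (length u - length v) c @ replicate (length x) c" for c :: 'z
    using greater by (simp flip: replicate_add)
  then show ?thesis using greater assms by (simp add: delta_def pad_def ended_def zip_append1)
qed

text \<open>A word cannot resume once its padding has begun.\<close>

lemma delta_append_imp:
  assumes eq: "delta X (u, v) @ z = delta X (a, b)"
  shows "\<exists>x y. unpad z = (x, y) \<and> a = u @ x \<and> b = v @ y \<and> (x, y) \<in> ended u v"
proof -
  obtain x y where z: "unpad z = (x, y)" by force
  have ab: "a = u @ x" "b = v @ y"
    using arg_cong[OF eq, of unpad] by (simp_all add: unpad_append unpad_delta z)
  have "x = []" if "length u < length v"
  proof (rule ccontr)
    assume "x \<noteq> []"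
    have "pad X (length v) u @ map fst z = pad X (length b) a"
      using arg_cong[OF eq, of "map fst"] by (simp add: map_fst_delta)
    \<comment> \<open>At position \<open>length u\<close> the left side has a padding loop and the
      right side the first letter of \<open>x\<close>.\<close>
    from arg_cong[OF this, of "\<lambda>l. l ! length u"] show False
      using that \<open>x \<noteq> []\<close> by (simp add: pad_def ab nth_append split: if_splits)
  qed
  moreover have "y = []" if "length v < length u"
  proof (rule ccontr)
    assume "y \<noteq> []"
    have "pad X (length u) v @ map snd z = pad X (length a) b"
      using arg_cong[OF eq, of "map snd"] by (simp add: map_snd_delta)
    from arg_cong[OF this, of "\<lambda>l. l ! length v"] show False
      using that \<open>y \<noteq> []\<close> by (simp add: pad_def ab nth_append split: if_splits)
  qed
  ultimately show ?thesis using z ab by (auto simp: ended_def)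
qed

text \<open>Residuals are quotients of the padded language with the padding forgotten, so finitely
  many quotients leave finitely many residuals.\<close>

lemma res_eq_unpad: "res R (u, v) = unpad ` lquot (delta X ` R) (delta X (u, v))"
proof (intro equalityI subrelI)
  fix x y assume "(x, y) \<in> res R (u, v)"
  then have R: "(u @ x, v @ y) \<in> R" and e: "(x, y) \<in> ended u v" by (auto simp: res_def)
  obtain z where z: "delta X (u @ x, v @ y) = delta X (u, v) @ z"
    using delta_append[OF e] by blast
  have "unpad z = (x, y)" using arg_cong[OF z, of unpad]
    by (simp add: unpad_append unpad_delta prod_eq_iff)
  moreover have "z \<in> lquot (delta X ` R) (delta X (u, v))"
    using R z unfolding lquot_def by (metis (mono_tags) image_eqI mem_Collect_eq)
  ultimately show "(x, y) \<in> unpad ` lquot (delta X ` R) (delta X (u, v))" by (metis image_eqI)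
next
  fix x y assume "(x, y) \<in> unpad ` lquot (delta X ` R) (delta X (u, v))"
  then obtain z a b where z: "unpad z = (x, y)" "delta X (u, v) @ z = delta X (a, b)" "(a, b) \<in> R"
    by (auto simp: lquot_def)
  then show "(x, y) \<in> res R (u, v)" using delta_append_imp[OF z(2)] by (auto simp: res_def)
qed

lemma synchronous_if_recognizable_delta:
  assumes "recognizable (delta X ` R)"
  shows "synchronous R"
proof (rule synchronous_factor[of "\<lambda>w. lquot (delta X ` R) (delta X w)"])
  show "finite (range (\<lambda>w. lquot (delta X ` R) (delta X w)))"
    using assms unfolding recognizable_def by (rule rev_finite_subset) auto
  show "res R w = unpad ` lquot (delta X ` R) (delta X w)" for w
    by (cases w) (simp add: res_eq_unpad)
qed

text \<open>A prefix of a padded reading is again one, so a word that is not a padded reading has an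
  empty quotient.\<close>

lemma delta_take:
  assumes "delta X (a, b) = w @ z"
  shows "w = delta X (take (length w) a, take (length w) b)"
proof -
  let ?n = "length w"
  have "?n \<le> max (length a) (length b)"
    using arg_cong[OF assms, of length] by (simp add: length_delta)
  moreover have "(drop ?n a, drop ?n b) \<in> ended (take ?n a) (take ?n b)"
    by (auto simp: ended_def)
  from delta_append[OF this, of X] obtain z'
    where "delta X (a, b) = delta X (take ?n a, take ?n b) @ z'" by auto
  ultimately show ?thesis using assms
    by (auto simp: append_eq_append_conv length_delta max_def min_def split: if_splits)
qed

text \<open>To restore the padding after a residual, the only further information is the target of
  each word read so far: it locates the loop when the continuation is empty.\<close>

lemma lquot_delta:
  "lquot (delta X ` R) (delta X (u, v)) =
    (\<lambda>(x, y). zip (map Inl x @ replicate (length y - length x)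
          (Inr (if x = [] then head X (last u) else head X (last x))))
        (map Inl y @ replicate (length x - length y)
          (Inr (if y = [] then head X (last v) else head X (last y))))) ` res R (u, v)"
  (is "_ = ?g ` _")
proof -
  have g: "delta X (u @ x, v @ y) = delta X (u, v) @ ?g (x, y)" if "(x, y) \<in> ended u v" for x y
    using delta_append[OF that, of X] by (simp add: last_append)
  show ?thesis
  proof (intro equalityI subsetI)
    fix z assume "z \<in> lquot (delta X ` R) (delta X (u, v))"
    then obtain a b where ab: "(a, b) \<in> R" "delta X (u, v) @ z = delta X (a, b)"
      by (auto simp: lquot_def)
    from delta_append_imp[OF this(2)] obtain x y
      where xy: "a = u @ x" "b = v @ y" "(x, y) \<in> ended u v" by blast
    then have "z = ?g (x, y)" using ab(2) g[OF xy(3)] by simp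
    moreover have "(x, y) \<in> res R (u, v)" using ab xy by (simp add: res_def)
    ultimately show "z \<in> ?g ` res R (u, v)" by blast
  next
    fix z assume "z \<in> ?g ` res R (u, v)"
    then obtain x y where z: "z = ?g (x, y)" and "(x, y) \<in> res R (u, v)" by (elim imageE) auto
    then have "(u @ x, v @ y) \<in> R" "(x, y) \<in> ended u v" by (auto simp: res_def)
    moreover from this have "delta X (u, v) @ z = delta X (u @ x, v @ y)"
      using g[of x y] z by simp
    ultimately show "z \<in> lquot (delta X ` R) (delta X (u, v))"
      by (simp only: lquot_def mem_Collect_eq imageI)
  qed
qed

lemma (in wf_digraph) paths_iff:
  "p \<in> paths G \<longleftrightarrow> p \<noteq> [] \<and> set p \<subseteq> arcs G \<and> successively (\<lambda>a b. head G a = tail G b) p"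
proof -
  have cas: "(\<exists>v. cas u p v) \<longleftrightarrow> tail G (hd p) = u \<and> successively (\<lambda>a b. head G a = tail G b) p"
    if "p \<noteq> []" for u
    using that
  proof (induction p arbitrary: u)
    case (Cons a p)
    show ?case
    proof (cases "p = []")
      case False
      then show ?thesis
        using Cons.IH[OF False, of "head G a"] by (auto simp: successively_Cons)
    qed simp
  qed simp
  show ?thesis
  proof (cases "p = []")
    case False
    have "tail G (hd p) \<in> verts G" if "set p \<subseteq> arcs G" using that False by (cases p) auto
    then show ?thesis using False cas[OF False] unfolding paths_def awalk_def by blast
  qed (simp add: paths_def)
qed

lemma synchronously_regular_iff:
  assumes "fin_digraph X"
  shows "synchronously_regular X R \<longleftrightarrow> R \<subseteq> paths X \<times> paths X \<and> synchronous R"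
proof -
  interpret fin_digraph X by fact
  have "recognizable (delta X ` R)" if R: "R \<subseteq> paths X \<times> paths X" "synchronous R"
  proof -
    let ?e = "\<lambda>u. head X (last u)"
    \<comment> \<open>The target of an empty prefix is an unspecified value, but only a single one,
      so the set stays finite.\<close>
    let ?V = "insert (?e []) (verts X)"
    let ?f = "\<lambda>(u, v). (res R (u, v), ?e u, ?e v)"
    have fin: "finite (?f ` {(u, v). ?e u \<in> ?V \<and> ?e v \<in> ?V})"
      by (rule finite_subset[of _ "range (res R) \<times> ?V \<times> ?V"])
        (use R(2) in \<open>auto simp: synchronous_def\<close>)
    have ends: "?e (take n a) \<in> ?V" if "a \<in> paths X" for n a
    proof (cases "take n a = []")
      case False
      then have "last (take n a) \<in> set a" using last_in_set in_set_takeD by fast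
      then show ?thesis using that by (auto simp: paths_iff)
    qed (simp only: insertI1)
    show ?thesis
      unfolding recognizable_def
    proof (rule finite_range_factor[OF fin, of _ "{}"])
      fix w
      let ?g = "\<lambda>(Q, h, k). (\<lambda>(x, y). zip (map Inl x @ replicate (length y - length x)
          (Inr (if x = [] then h else head X (last x))))
        (map Inl y @ replicate (length x - length y)
          (Inr (if y = [] then k else head X (last y))))) ` Q"
      show "lquot (delta X ` R) w = {} \<or>
        (\<exists>y\<in>{(u, v). ?e u \<in> ?V \<and> ?e v \<in> ?V}. lquot (delta X ` R) w = ?g (?f y))"
      proof (rule disjCI)
        assume "\<not> (\<exists>y\<in>{(u, v). ?e u \<in> ?V \<and> ?e v \<in> ?V}. lquot (delta X ` R) w = ?g (?f y))"
        then have no: "w \<noteq> delta X (u, v)" if "?e u \<in> ?V" "?e v \<in> ?V" for u v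
          using that lquot_delta[of X R u v] by auto
        show "lquot (delta X ` R) w = {}"
        proof (rule ccontr)
          assume "lquot (delta X ` R) w \<noteq> {}"
          then obtain z a b where ab: "(a, b) \<in> R" "delta X (a, b) = w @ z"
            unfolding lquot_def by (smt (verit) emptyE equals0I imageE mem_Collect_eq prod.exhaust)
          then show False
            using delta_take[OF ab(2)] ends[of a] ends[of b] R(1) no by blast
        qed
      qed
    qed
  qed
  moreover have "delta X ` R \<subseteq> lists (arcs (prod_graph (dollar_graph X) (dollar_graph X)))"
    if R: "R \<subseteq> paths X \<times> paths X"
  proof -
    have pad: "set (pad X n a) \<subseteq> Inl ` arcs X \<union> Inr ` verts X" if "a \<in> paths X" for n a
    proof -
      have "last a \<in> arcs X" using that last_in_set[of a] by (auto simp: paths_iff)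
      then show ?thesis using that by (auto simp: pad_def paths_iff)
    qed
    show ?thesis
    proof
      fix w assume "w \<in> delta X ` R"
      then obtain a b where ab: "a \<in> paths X" "b \<in> paths X" "w = delta X (a, b)" using R by auto
      have "set w \<subseteq> set (pad X (length b) a) \<times> set (pad X (length a) b)"
        unfolding ab(3) delta_def by (auto dest: set_zip_leftD set_zip_rightD)
      also have "\<dots> \<subseteq> arcs (prod_graph (dollar_graph X) (dollar_graph X))"
        using pad[OF ab(1)] pad[OF ab(2)]
        unfolding prod_graph_def dollar_graph_def pre_digraph.simps by (intro Sigma_mono)
      finally show "w \<in> lists (arcs (prod_graph (dollar_graph X) (dollar_graph X)))" by auto
    qed
  qed
  ultimately show ?thesis
    unfolding synchronously_regular_def
    using recognizable_imp_regular[of "delta X ` R"] regular_imp_recognizable[of _ "delta X ` R"]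
      synchronous_if_recognizable_delta[of X R]
    by blast
qed

lemma (in wf_digraph) paths_append_iff:
  assumes "p \<noteq> []" "q \<noteq> []"
  shows "p @ q \<in> paths G \<longleftrightarrow> p \<in> paths G \<and> q \<in> paths G \<and> head G (last p) = tail G (hd q)"
  using assms by (auto simp: paths_iff successively_append_iff)

section \<open>Automatic structures\<close>

locale automatic_representation = semigroupoid S
  for S :: "('o, 'a) pre_semigroupoid" (structure) +
  fixes X :: "('o, 'e) pre_digraph" and K :: "'e list set" and \<rho> :: "'e list \<Rightarrow> 'a"
  assumes automatic: "automatic_structure S X K \<rho>"
begin

lemma fin_digraph_X: "fin_digraph X"
  using automatic by (simp add: automatic_structure_def)

sublocale X: fin_digraph X by (rule fin_digraph_X)

lemma choice: "choice_of_representatives S X K \<rho>"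
  using automatic by (simp add: automatic_structure_def)

lemma K_paths: "K \<subseteq> paths X" and rho_paths: "\<rho> ` paths X = arcs S" and rho_K: "\<rho> ` K = arcs S"
  using choice by (simp_all add: choice_of_representatives_def)

lemma rho_closed: "p \<in> paths X \<Longrightarrow> \<rho> p \<in> arcs S"
  using rho_paths by blast

lemma tail_rho: "p \<in> paths X \<Longrightarrow> tail S (\<rho> p) = tail X (hd p)"
  and head_rho: "p \<in> paths X \<Longrightarrow> head S (\<rho> p) = head X (last p)"
  and rho_append: "p \<in> paths X \<Longrightarrow> q \<in> paths X \<Longrightarrow> head X (last p) = tail X (hd q) \<Longrightarrow>
    \<rho> (p @ q) = mult S (\<rho> p) (\<rho> q)"
  using choice
  by (simp_all add: choice_of_representatives_def semigroupoid_hom_def free_semigroupoid_def)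

lemma path_ConsD:
  assumes "e # p \<in> paths X" "p \<noteq> []"
  shows "[e] \<in> paths X" "p \<in> paths X" "head X e = tail X (hd p)"
  using X.paths_append_iff[of "[e]" p] assms by simp_all

lemma last_path: "p \<in> paths X \<Longrightarrow> last p \<in> arcs X"
  using last_in_set[of p] by (auto simp: X.paths_iff)

lemma synchronous_rel_edge: "e \<in> arcs X \<Longrightarrow> synchronous (rel_edge X K \<rho> e)"
  using automatic by (auto simp: automatic_structure_def synchronously_regular_iff)

text \<open>Equal values force equal targets, so the relation is the union of the vertex relations
  over the finitely many vertices.\<close>

lemma synchronous_rel_eq: "synchronous {(u, v). u \<in> K \<and> v \<in> K \<and> \<rho> u = \<rho> v}"
proof -
  have "{(u, v). u \<in> K \<and> v \<in> K \<and> \<rho> u = \<rho> v} = (\<Union>a\<in>verts X. rel_vertex X K \<rho> a)"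
    using K_paths last_path by (auto simp: rel_vertex_def)
  also have "synchronous \<dots>"
    using automatic
    by (intro synchronous_UN) (auto simp: automatic_structure_def synchronously_regular_iff)
  finally show ?thesis .
qed

lemma recognizable_K: "recognizable K"
  using recognizable_diagonal[OF synchronous_rel_eq] by simp

text \<open>Induction on the letters of \<open>w\<close>: since \<open>K\<close> represents every
  arrow, each intermediate product has a representative through which the relations can be
  composed.\<close>

lemma synchronous_rel_path:
  assumes "w \<in> paths X"
  shows "synchronous {(u, v). u \<in> K \<and> v \<in> K \<and> head X (last u) = tail X (hd w) \<and> \<rho> (u @ w) = \<rho> v}"
    (is "synchronous (?R w)")
  using assms
proof (induction w rule: rev_induct)
  case (snoc e w)
  show ?case
  proof (cases "w = []")
    case True
    have "e \<in> arcs X" using snoc.prems by (auto simp: X.paths_iff)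
    then show ?thesis using synchronous_rel_edge[of e] True by (simp add: rel_edge_def)
  next
    case False
    then have we: "w \<in> paths X" "[e] \<in> paths X" "head X (last w) = tail X e"
      using snoc.prems X.paths_append_iff[of w "[e]"] by simp_all
    have split: "\<rho> (u @ w @ [e]) = mult S (\<rho> (u @ w)) (\<rho> [e])" "u @ w \<in> paths X"
      if "u \<in> paths X" "head X (last u) = tail X (hd w)" for u
    proof -
      show uw: "u @ w \<in> paths X"
        using that we False X.paths_append_iff[of u w] by (auto simp: X.paths_iff)
      show "\<rho> (u @ w @ [e]) = mult S (\<rho> (u @ w)) (\<rho> [e])"
        using rho_append[OF uw we(2)] we(3) False by simp
    qed
    have "?R (w @ [e]) = ?R w O rel_edge X K \<rho> e"
    proof (intro equalityI subrelI)
      fix u v assume "(u, v) \<in> ?R (w @ [e])"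
      then have uv: "u \<in> K" "v \<in> K" "head X (last u) = tail X (hd w)" "\<rho> (u @ w @ [e]) = \<rho> v"
        using False by auto
      have u: "u \<in> paths X" using uv K_paths by blast
      note s = split[OF u uv(3)]
      obtain m where m: "m \<in> K" "\<rho> m = \<rho> (u @ w)"
        using rho_closed[OF s(2)] rho_K by (metis imageE)
      have mp: "m \<in> paths X" using m K_paths by blast
      have "head X (last m) = tail X e"
        using head_rho[OF mp] head_rho[OF s(2)] m(2) we(3) False by simp
      moreover from this have "\<rho> (m @ [e]) = \<rho> v"
        using rho_append[OF mp we(2)] uv(4) s(1) m(2) by simp
      ultimately show "(u, v) \<in> ?R w O rel_edge X K \<rho> e"
        using uv m by (auto simp: rel_edge_def intro!: relcompI[of _ m])
    next
      fix u v assume "(u, v) \<in> ?R w O rel_edge X K \<rho> e"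
      then obtain m where m: "u \<in> K" "m \<in> K" "head X (last u) = tail X (hd w)" "\<rho> (u @ w) = \<rho> m"
        "v \<in> K" "head X (last m) = tail X e" "\<rho> (m @ [e]) = \<rho> v"
        by (auto simp: rel_edge_def)
      have "u \<in> paths X" "m \<in> paths X" using m K_paths by auto
      then show "(u, v) \<in> ?R (w @ [e])"
        using m False split(1)[of u] rho_append[OF _ we(2), of m] by simp
    qed
    then show ?thesis
      using synchronous_relcomp[OF snoc.IH[OF we(1)] synchronous_rel_edge[of e]] we(2)
      by (simp add: X.paths_iff)
  qed
qed (simp add: X.paths_iff)

lemma synchronous_rel_arc:
  assumes "t \<in> arcs S"
  shows "synchronous {(u, v). u \<in> K \<and> v \<in> K \<and> head X (last u) = tail S t \<and> mult S (\<rho> u) t = \<rho> v}"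
proof -
  obtain w where w: "w \<in> paths X" "\<rho> w = t" using assms rho_paths by (metis imageE)
  have "mult S (\<rho> u) t = \<rho> (u @ w)" if "u \<in> K" "head X (last u) = tail S t" for u
    using rho_append[of u w] that w tail_rho[OF w(1)] K_paths by auto
  then have "{(u, v). u \<in> K \<and> v \<in> K \<and> head X (last u) = tail S t \<and> mult S (\<rho> u) t = \<rho> v} =
      {(u, v). u \<in> K \<and> v \<in> K \<and> head X (last u) = tail X (hd w) \<and> \<rho> (u @ w) = \<rho> v}"
    using tail_rho[OF w(1)] w(2) by auto
  then show ?thesis using synchronous_rel_path[OF w(1)] by simp
qed

section \<open>Deleting identities, and pumping\<close>

lemma rho_drop_identities:
  assumes "m @ r \<in> paths X" "r \<noteq> []" "\<And>e. e \<in> set m \<Longrightarrow> identity_element S (\<rho> [e])"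
  shows "r \<in> paths X \<and> tail X (hd r) = tail X (hd (m @ r)) \<and> \<rho> (m @ r) = \<rho> r"
  using assms
proof (induction m)
  case (Cons e m)
  have "e # (m @ r) \<in> paths X" "m @ r \<noteq> []"
    using Cons.prems(1,2) by simp_all
  note e = path_ConsD[OF this]
  have id: "identity_element S (\<rho> [e])" using Cons.prems by simp
  have "\<rho> (e # m @ r) = mult S (\<rho> [e]) (\<rho> (m @ r))"
    using rho_append[OF e(1,2)] e(3) by simp
  also have "\<dots> = \<rho> (m @ r)"
    using id e(3) rho_closed[OF e(2)] tail_rho[OF e(2)] head_rho[OF e(1)]
    by (simp add: identity_element_def)
  finally have "\<rho> (e # m @ r) = \<rho> (m @ r)" .
  moreover have "tail X e = head X e"
    using id head_rho[OF e(1)] tail_rho[OF e(1)] by (simp add: identity_element_def)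
  moreover have "r \<in> paths X \<and> tail X (hd r) = tail X (hd (m @ r)) \<and> \<rho> (m @ r) = \<rho> r"
    using Cons.prems by (intro Cons.IH e(2)) auto
  ultimately show ?case using e(3) by simp
qed simp

text \<open>Identities are loops, so \<open>p\<close> still meets \<open>r\<close> after the
  deletion. Since \<open>r\<close> is non-empty, every deleted letter acts from the left on an
  arrow.\<close>

lemma rho_remove_identities:
  assumes "p @ m @ r \<in> paths X" "r \<noteq> []" "\<And>e. e \<in> set m \<Longrightarrow> identity_element S (\<rho> [e])"
  shows "\<rho> (p @ m @ r) = \<rho> (p @ r)"
proof (cases "p = []")
  case False
  then have p: "p \<in> paths X" "m @ r \<in> paths X" "head X (last p) = tail X (hd (m @ r))"
    using assms X.paths_append_iff[of p "m @ r"] by simp_all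
  then show ?thesis
    using rho_append[of p] rho_drop_identities[OF p(2) assms(2,3)] by simp
qed (use rho_drop_identities assms in simp)

lemma identities_if_not_in_right_ideal:
  assumes T: "\<And>s q. \<lbrakk>s \<in> arcs S; \<not> identity_element S s; q \<in> arcs S; head S s = tail S q\<rbrakk>
      \<Longrightarrow> mult S s q \<in> T"
    and "m @ r \<in> paths X" "r \<noteq> []" "\<rho> (m @ r) \<notin> T" "e \<in> set m"
  shows "identity_element S (\<rho> [e])"
  using assms(2-)
proof (induction m)
  case (Cons f m)
  have "f # (m @ r) \<in> paths X" "m @ r \<noteq> []"
    using Cons.prems(1,2) by simp_all
  note f = path_ConsD[OF this]
  have prod: "\<rho> (f # m @ r) = mult S (\<rho> [f]) (\<rho> (m @ r))"
    using rho_append[OF f(1,2)] f(3) by simp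
  have id: "identity_element S (\<rho> [f])"
  proof (rule ccontr)
    assume "\<not> identity_element S (\<rho> [f])"
    then have "\<rho> (f # m @ r) \<in> T"
      unfolding prod using f by (intro T) (simp_all add: rho_closed tail_rho head_rho)
    then show False using Cons.prems by simp
  qed
  then have "\<rho> (f # m @ r) = \<rho> (m @ r)"
    using rho_drop_identities[of "[f]" "m @ r"] Cons.prems by simp
  then show ?case using Cons.IH[OF f(2)] Cons.prems id by auto
qed simp

text \<open>One more than the number n of left quotients of \<open>K\<close>: without its last
  letter a block has n letters, hence n + 1 prefixes, two of which lead to the same
  quotient.\<close>

definition block_length :: nat where
  "block_length = Suc (card (range (lquot K)))"

text \<open>A factor of length \<open>block_length\<close> whose value avoids \<open>T\<close> consists of identities except
  perhaps for its last letter, so by pumping it can be shortened without changing the value: a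
  representative of minimal length contains no such factor.\<close>

lemma representative_with_factors_in_right_ideal:
  assumes T: "\<And>s q. \<lbrakk>s \<in> arcs S; \<not> identity_element S s; q \<in> arcs S; head S s = tail S q\<rbrakk>
      \<Longrightarrow> mult S s q \<in> T"
    and t: "t \<in> arcs S"
  shows "\<exists>w\<in>K. \<rho> w = t \<and> (\<forall>p b q. w = p @ b @ q \<and> length b = block_length \<longrightarrow> \<rho> b \<in> T)"
proof -
  obtain w0 where "w0 \<in> K \<and> \<rho> w0 = t" using t rho_K by (metis imageE)
  from ex_has_least_nat[of "\<lambda>w. w \<in> K \<and> \<rho> w = t", OF this, of length] obtain w
    where w: "w \<in> K" "\<rho> w = t" and least: "\<And>y. y \<in> K \<Longrightarrow> \<rho> y = t \<Longrightarrow> length w \<le> length y"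
    by auto
  have "\<rho> b \<in> T" if dec: "w = p @ b @ q" and len: "length b = block_length" for p b q
  proof (rule ccontr)
    assume bad: "\<rho> b \<notin> T"
    define n where "n = card (range (lquot K))"
    obtain m e where b: "b = m @ [e]" and m: "length m = n"
      using len by (cases b rule: rev_cases) (auto simp: block_length_def n_def)
    have wp: "w \<in> paths X" using w K_paths by blast
    have "b \<in> paths X"
    proof -
      have "b @ q \<in> paths X"
        using wp dec b X.paths_append_iff[of p "b @ q"] by (cases "p = []") auto
      then show ?thesis using b X.paths_append_iff[of b q] by (cases "q = []") auto
    qed
    then have "m @ [e] \<in> paths X" "[e] \<noteq> []" "\<rho> (m @ [e]) \<notin> T" using b bad by simp_all
    note ids = identities_if_not_in_right_ideal[of T m "[e]", rotated, OF this]
    have ids: "identity_element S (\<rho> [f])" if "f \<in> set m" for f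
      using that by (rule ids) (rule T)
    let ?f = "\<lambda>j. lquot K (p @ take j m)"
    have "\<not> inj_on ?f {..n}"
    proof
      assume "inj_on ?f {..n}"
      then have "card {..n} \<le> card (range (lquot K))"
        by (rule card_inj_on_le) (use recognizable_K in \<open>auto simp: recognizable_def\<close>)
      then show False by (simp add: n_def)
    qed
    then obtain j k where jk: "j < k" "k \<le> n" "?f j = ?f k"
      unfolding inj_on_def by (metis atMost_iff linorder_neqE_nat)
    define r where "r = drop k m @ e # q"
    have wk: "w = (p @ take k m) @ r" by (simp add: dec b r_def)
    have "r \<in> ?f k" using w(1) wk by (simp add: lquot_def)
    then have "r \<in> ?f j" unfolding jk(3) .
    then have short: "(p @ take j m) @ r \<in> K" by (simp add: lquot_def)
    have wj: "w = (p @ take j m) @ drop j (take k m) @ r"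
      using jk(1) append_take_drop_id[of j "take k m"] unfolding wk by (simp add: min_def)
    have "\<rho> w = \<rho> ((p @ take j m) @ r)"
      unfolding wj
    proof (rule rho_remove_identities)
      show "identity_element S (\<rho> [f])" if "f \<in> set (drop j (take k m))" for f
        using that ids by (meson in_set_dropD in_set_takeD)
    qed (use wp wj in \<open>simp_all add: r_def\<close>)
    then have "length w \<le> length ((p @ take j m) @ r)" using least[OF short] w(2) by simp
    then show False using jk m unfolding wk by simp
  qed
  then show ?thesis using w by blast
qed

end

section \<open>Rees matrix semigroups\<close>

context rees_matrix_data
begin

lemma ex_F: "x \<in> arcs S \<Longrightarrow> \<exists>i\<in>I. F i = tail S x"
  and ex_G: "x \<in> arcs S \<Longrightarrow> \<exists>l\<in>\<Lambda>. G l = head S x"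
  and ex_tail: "i \<in> I \<Longrightarrow> \<exists>x\<in>arcs S. tail S x = F i"
  and ex_head: "l \<in> \<Lambda> \<Longrightarrow> \<exists>x\<in>arcs S. head S x = G l"
  using F_surj G_surj by (metis imageE imageI)+

text \<open>A non-zero product takes its column index from the left factor and its row index from
  the right one, so every index occurs in a generator.\<close>

lemma finite_index_sets:
  assumes "finitely_generated (rees_matrix_semigroup S I \<Lambda> F G P)"
  shows "finite I" "finite \<Lambda>"
proof -
  let ?M = "rees_matrix_semigroup S I \<Lambda> F G P"
  obtain A where A: "finite A" "generated ?M A = arcs ?M"
    using assms by (auto simp: finitely_generated_def)
  have gen: "i \<in> (\<lambda>m. fst (the m)) ` A \<and> l \<in> (\<lambda>m. snd (snd (the m))) ` A"
    if "m \<in> generated ?M A" "m = Some (i, x, l)" for m i x l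
    using that
  proof (induction arbitrary: i x l rule: generated.induct)
    case (generated_incl a)
    then show ?case by (intro conjI image_eqI[of _ _ a]) simp_all
  next
    case (generated_mult a b)
    from generated_mult.prems obtain j y m x' j' y' m'
      where ab: "a = Some (j, y, m)" "b = Some (j', y', m')"
      by (cases a; cases b) (auto simp: rees_matrix_semigroup_def)
    then have "j = i" "m' = l"
      using generated_mult.prems by (simp_all add: rees_matrix_semigroup_def split: option.splits)
    then show ?case using generated_mult.IH ab by blast
  qed
  have "I \<subseteq> (\<lambda>m. fst (the m)) ` A"
  proof
    fix i assume i: "i \<in> I"
    then obtain x where x: "x \<in> arcs S" "tail S x = F i" using ex_tail by blast
    then obtain l where "l \<in> \<Lambda>" "G l = head S x" using ex_G by blast
    then have "Some (i, x, l) \<in> arcs ?M" using i x by (auto simp: rees_matrix_semigroup_def)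
    then show "i \<in> (\<lambda>m. fst (the m)) ` A" using gen A by blast
  qed
  then show "finite I" using A finite_surj by blast
  have "\<Lambda> \<subseteq> (\<lambda>m. snd (snd (the m))) ` A"
  proof
    fix l assume l: "l \<in> \<Lambda>"
    then obtain x where x: "x \<in> arcs S" "head S x = G l" using ex_head by blast
    then obtain i where "i \<in> I" "F i = tail S x" using ex_F by blast
    then have "Some (i, x, l) \<in> arcs ?M" using l x by (auto simp: rees_matrix_semigroup_def)
    then show "l \<in> (\<lambda>m. snd (snd (the m))) ` A" using gen A by blast
  qed
  then show "finite \<Lambda>" using A finite_surj by blast
qed

end

lemma foldl_assoc:
  assumes "\<And>a b. a \<in> A \<Longrightarrow> b \<in> A \<Longrightarrow> f a b \<in> A"
    and "\<And>a b c. a \<in> A \<Longrightarrow> b \<in> A \<Longrightarrow> c \<in> A \<Longrightarrow> f a (f b c) = f (f a b) c"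
    and "a \<in> A" "b \<in> A" "set xs \<subseteq> A"
  shows "f a (foldl f b xs) = foldl f (f a b) xs"
  using assms(3-) by (induction xs arbitrary: b) (simp_all add: assms(1,2))

locale rees_coding =
  rees_matrix_data S I \<Lambda> F G P + automatic_representation S X K \<rho>
  for S :: "('o, 'a) pre_semigroupoid" (structure)
    and I :: "'i set" and \<Lambda> :: "'l set" and F :: "'i \<Rightarrow> 'o" and G :: "'l \<Rightarrow> 'o"
    and P :: "'l \<Rightarrow> 'i \<Rightarrow> 'a option"
    and X :: "('o, nat) pre_digraph" and K :: "nat list set" and \<rho> :: "nat list \<Rightarrow> 'a" +
  fixes \<Lambda>' :: "'l set"
  assumes finite_I: "finite I" and finite_\<Lambda>: "finite \<Lambda>"
    and rows: "\<Lambda>' \<subseteq> \<Lambda>" "bij_betw G \<Lambda>' (head S ` arcs S)"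
    and generation: "\<And>t. t \<in> arcs S \<Longrightarrow> \<not> identity_element S t \<Longrightarrow>
      \<exists>l\<in>\<Lambda>'. \<exists>i\<in>I. \<exists>p. P l i = Some p \<and>
        (t = p \<or> (\<exists>s\<in>arcs S. head S p = tail S s \<and> t = mult S p s))"
begin

abbreviation "M \<equiv> rees_matrix_semigroup S I \<Lambda> F G P"

section \<open>Factorization through entries of the row cross-section\<close>

definition row :: "'o \<Rightarrow> 'l" where
  "row = inv_into \<Lambda>' G"

lemma row: "v \<in> head S ` arcs S \<Longrightarrow> row v \<in> \<Lambda>' \<and> G (row v) = v"
  using rows(2) unfolding row_def bij_betw_def by (metis f_inv_into_f inv_into_into)

lemma row_G: "l \<in> \<Lambda>' \<Longrightarrow> row (G l) = l"
  using rows(2) unfolding row_def bij_betw_def by (meson inv_into_f_f)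

text \<open>The row is computed from the source of \<open>t\<close>, so a block need not store it.
  As \<open>inv_into\<close> is arbitrary off the image of \<open>G\<close>, membership in
  \<open>\<Lambda>'\<close> is stated explicitly.\<close>

definition factors :: "'a \<Rightarrow> 'i \<times> 'a \<Rightarrow> bool" where
  "factors t = (\<lambda>(j, s). row (tail S t) \<in> \<Lambda>' \<and> j \<in> I \<and> s \<in> arcs S \<and>
     (\<exists>p. P (row (tail S t)) j = Some p \<and> head S p = tail S s \<and> t = mult S p s))"

definition right_ideal :: "'a set" where
  "right_ideal = {t. \<exists>js. factors t js}"

lemma right_idealI:
  assumes "l \<in> \<Lambda>'" "j \<in> I" "P l j = Some p" "s \<in> arcs S" "head S p = tail S s"
  shows "mult S p s \<in> right_ideal"
proof -
  have p: "p \<in> arcs S" "tail S p = G l" using P_entry[of l j p] assms rows by auto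
  then have "row (tail S (mult S p s)) = l" using assms by (simp add: tail_mult row_G)
  then show ?thesis using assms by (auto simp: right_ideal_def factors_def)
qed

text \<open>Weak generation suffices here: if \<open>s\<close> is a bare matrix entry,
  \<open>q\<close> supplies the second factor; otherwise \<open>q\<close> is absorbed into the
  factor already present.\<close>

lemma mult_in_right_ideal:
  assumes "s \<in> arcs S" "\<not> identity_element S s" "q \<in> arcs S" "head S s = tail S q"
  shows "mult S s q \<in> right_ideal"
proof -
  obtain l i p where p: "l \<in> \<Lambda>'" "i \<in> I" "P l i = Some p"
    and "s = p \<or> (\<exists>r\<in>arcs S. head S p = tail S r \<and> s = mult S p r)"
    using generation[OF assms(1,2)] by blast
  then consider "s = p" | r where "r \<in> arcs S" "head S p = tail S r" "s = mult S p r" by blast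
  then show ?thesis
  proof cases
    case 1
    then show ?thesis using right_idealI[OF p] assms by simp
  next
    case (2 r)
    have arc: "p \<in> arcs S" using P_entry[of l i p] p rows by auto
    then have "head S r = tail S q" using 2 assms by (simp add: head_mult)
    then show ?thesis
      using right_idealI[OF p, of "mult S r q"] 2 assms arc
      by (simp add: mult_closed tail_mult mult_assoc)
  qed
qed

definition factor :: "'a \<Rightarrow> 'i \<times> 'a" where
  "factor t = (SOME js. factors t js)"

lemma factorE:
  assumes "t \<in> right_ideal"
  obtains j s p where "factor t = (j, s)" "row (tail S t) \<in> \<Lambda>'" "j \<in> I" "s \<in> arcs S"
    "P (row (tail S t)) j = Some p" "p \<in> arcs S" "head S p = F j" "F j = tail S s" "t = mult S p s"
proof -
  have "factors t (factor t)"
    using assms unfolding right_ideal_def factor_def by (auto intro: someI)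
  then show ?thesis
    using that rows(1) P_entry[of "row (tail S t)"] by (cases "factor t") (fastforce simp: factors_def)
qed

text \<open>A letter \<open>Some (io, b, lo)\<close> stands for a block \<open>b\<close> of a path over \<open>X\<close>. The first block of a
  path carries its column index in \<open>io\<close>; every other block is read as \<open>P\<^bsub>\<lambda>j\<^esub>s\<close>, where \<open>\<lambda>\<close> is the row
  of the cross-section at the end of the preceding block. The last block carries its row index in
  \<open>lo\<close>. The letter \<open>None\<close> stands for the zero.\<close>

definition letters :: "('i option \<times> nat list \<times> 'l option) option set" where
  "letters = insert None (Some ` {(io, b, lo). b \<in> paths X \<and> length b \<le> block_length \<and>
     (case io of None \<Rightarrow> length b = block_length \<and> \<rho> b \<in> right_ideal
      | Some i \<Rightarrow> i \<in> I \<and> F i = tail X (hd b)) \<and>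
     (case lo of None \<Rightarrow> True | Some l \<Rightarrow> l \<in> \<Lambda> \<and> G l = head X (last b))})"

lemma finite_letters: "finite letters"
proof -
  have "letters \<subseteq> insert None (Some ` (insert None (Some ` I) \<times>
      {b. set b \<subseteq> arcs X \<and> length b \<le> block_length} \<times> insert None (Some ` \<Lambda>)))"
    unfolding letters_def
    by (intro insert_mono image_mono)
      (auto simp: X.paths_iff image_iff split: option.splits; metis option.exhaust)
  then show ?thesis
    by (rule finite_subset) (use finite_I finite_\<Lambda> in \<open>simp add: finite_lists_length_le\<close>)
qed

text \<open>The edges of the witnessing graph have to be natural numbers, so the finitely many
  letters are numbered.\<close>

definition codes :: "nat set" where
  "codes = {0..<card letters}"

definition decode :: "nat \<Rightarrow> ('i option \<times> nat list \<times> 'l option) option" where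
  "decode = (SOME h. bij_betw h codes letters)"

lemma decode_bij: "bij_betw decode codes letters"
  unfolding decode_def codes_def by (rule someI_ex[OF ex_bij_betw_nat_finite[OF finite_letters]])

lemma decode_letters: "a \<in> codes \<Longrightarrow> decode a \<in> letters"
  using decode_bij by (auto simp: bij_betw_def)

lemma ex_code: "x \<in> letters \<Longrightarrow> \<exists>a\<in>codes. decode a = x"
  using decode_bij unfolding bij_betw_def by (metis imageE)

lemma code_cases:
  assumes "a \<in> codes" "decode a = Some (io, b, lo)"
  shows "b \<in> paths X" "length b \<le> block_length"
    "io = None \<Longrightarrow> length b = block_length \<and> \<rho> b \<in> right_ideal"
    "io = Some i \<Longrightarrow> i \<in> I \<and> F i = tail X (hd b)"
    "lo = Some l \<Longrightarrow> l \<in> \<Lambda> \<and> G l = head X (last b)"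
  using decode_letters[OF assms(1)] assms(2) by (auto simp: letters_def)

definition block :: "nat \<Rightarrow> nat list" where
  "block a = (case decode a of None \<Rightarrow> [] | Some (io, b, lo) \<Rightarrow> b)"

text \<open>Without a row index of its own, a letter ends in the cross-section row at the target of
  its block, which is the row used to factor a block that follows.\<close>

definition end_row :: "nat \<Rightarrow> 'l" where
  "end_row a = (case decode a of Some (io, b, Some l) \<Rightarrow> l | _ \<Rightarrow> row (head X (last (block a))))"

text \<open>A letter without column index contributes only the second factor of
  \<open>\<rho> b\<close>; the first is the matrix entry inserted by multiplication with the
  preceding letter.\<close>

definition letter_value :: "nat \<Rightarrow> ('i \<times> 'a \<times> 'l) option" where
  "letter_value a = (case decode a of None \<Rightarrow> None
     | Some (Some i, b, lo) \<Rightarrow> Some (i, \<rho> b, end_row a)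
     | Some (None, b, lo) \<Rightarrow> Some (fst (factor (\<rho> b)), snd (factor (\<rho> b)), end_row a))"

definition zero :: nat where
  "zero = (SOME a. a \<in> codes \<and> decode a = None)"

lemma zero: "zero \<in> codes" "decode zero = None"
proof -
  have "\<exists>a. a \<in> codes \<and> decode a = None" using ex_code[of None] by (auto simp: letters_def)
  from someI_ex[OF this] show "zero \<in> codes" "decode zero = None" by (simp_all add: zero_def)
qed

lemma zero_value [simp]: "letter_value zero = None"
  by (simp add: letter_value_def zero)

lemma head_row: "b \<in> paths X \<Longrightarrow> row (head X (last b)) \<in> \<Lambda>' \<and> G (row (head X (last b))) = head X (last b)"
  by (rule row) (metis head_rho image_eqI rho_closed)

lemma end_row:
  assumes "a \<in> codes" "decode a = Some (io, b, lo)"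
  shows "end_row a \<in> \<Lambda>" "G (end_row a) = head X (last b)"
  using code_cases[OF assms] head_row[of b] rows(1) assms
  by (auto simp: end_row_def block_def split: option.splits)

lemma letter_value_arc:
  assumes "a \<in> codes"
  shows "letter_value a \<in> arcs M"
proof (cases "decode a")
  case None
  then show ?thesis by (simp add: letter_value_def rees_matrix_semigroup_def)
next
  case (Some y)
  obtain io b lo where y: "y = (io, b, lo)" by (cases y)
  note d = Some[unfolded y]
  note c = code_cases[OF assms d] and e = end_row[OF assms d]
  show ?thesis
  proof (cases io)
    case None
    then have "\<rho> b \<in> right_ideal" using c by simp
    then obtain j s p where f: "factor (\<rho> b) = (j, s)" "j \<in> I" "s \<in> arcs S" "p \<in> arcs S"
      "head S p = F j" "F j = tail S s" "\<rho> b = mult S p s"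
      by (rule factorE)
    then have "head S s = head X (last b)" using c(1) by (simp add: head_mult flip: head_rho)
    then show ?thesis
      using f e None by (simp add: letter_value_def d rees_matrix_semigroup_def)
  next
    case (Some i)
    then show ?thesis
      using c e by (simp add: letter_value_def d rees_matrix_semigroup_def rho_closed tail_rho head_rho)
  qed
qed

section \<open>Words of letters and their values\<close>

definition decoding :: "nat list \<Rightarrow> nat list" where
  "decoding x = concat (map block x)"

lemma decoding_simps [simp]:
  "decoding [] = []" "decoding (a # x) = block a @ decoding x"
  "decoding (x @ y) = decoding x @ decoding y"
  by (simp_all add: decoding_def)

definition starting :: "'i \<Rightarrow> nat set" where
  "starting i = {a \<in> codes. \<exists>b lo. decode a = Some (Some i, b, lo)}"

definition inner :: "nat set" where
  "inner = {a \<in> codes. \<exists>b lo. decode a = Some (None, b, lo)}"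

definition nonfinal :: "nat set" where
  "nonfinal = {a \<in> codes. \<exists>io b. decode a = Some (io, b, None)}"

definition final :: "'l \<Rightarrow> nat set" where
  "final l = {a \<in> codes. \<exists>io b. decode a = Some (io, b, Some l)}"

text \<open>Unlike \<open>final l\<close>, this admits letters without a row index, because a proper
  prefix of a representative ends in such a letter.\<close>

definition ending :: "'l \<Rightarrow> nat set" where
  "ending l = {a \<in> codes. decode a \<noteq> None \<and> end_row a = l}"

definition chain :: "'i \<Rightarrow> 'l \<Rightarrow> nat list set" where
  "chain i l = {x. x \<noteq> [] \<and> hd x \<in> starting i} \<inter> {x. set (tl x) \<subseteq> inner} \<inter>
     {x. set (butlast x) \<subseteq> nonfinal} \<inter> {x. x \<noteq> [] \<and> last x \<in> ending l}"

definition words :: "'i \<Rightarrow> 'l \<Rightarrow> nat list set" where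
  "words i l = chain i l \<inter> {x. x \<noteq> [] \<and> last x \<in> final l} \<inter> {x. decoding x \<in> K}"

definition value_of :: "nat list \<Rightarrow> ('i \<times> 'a \<times> 'l) option" where
  "value_of x = foldl (rees_mult S P) (letter_value (hd x)) (map letter_value (tl x))"

lemma rees_mult_closed: "a \<in> arcs M \<Longrightarrow> b \<in> arcs M \<Longrightarrow> rees_mult S P a b \<in> arcs M"
  and rees_mult_assoc: "a \<in> arcs M \<Longrightarrow> b \<in> arcs M \<Longrightarrow> c \<in> arcs M \<Longrightarrow>
    rees_mult S P a (rees_mult S P b c) = rees_mult S P (rees_mult S P a b) c"
proof -
  interpret M: semigroupoid M by (rule semigroupoid_rees_matrix_semigroup)
  show "a \<in> arcs M \<Longrightarrow> b \<in> arcs M \<Longrightarrow> rees_mult S P a b \<in> arcs M"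
    "a \<in> arcs M \<Longrightarrow> b \<in> arcs M \<Longrightarrow> c \<in> arcs M \<Longrightarrow>
      rees_mult S P a (rees_mult S P b c) = rees_mult S P (rees_mult S P a b) c"
    using M.mult_closed M.mult_assoc by (simp_all add: rees_matrix_semigroup_def)
qed

lemma value_of_closed:
  assumes "x \<noteq> []" "set x \<subseteq> codes"
  shows "value_of x \<in> arcs M"
proof -
  have "foldl (rees_mult S P) m (map letter_value y) \<in> arcs M"
    if "m \<in> arcs M" "set y \<subseteq> codes" for m y
    using that by (induction y arbitrary: m) (simp_all add: rees_mult_closed letter_value_arc)
  then show ?thesis
    using assms letter_value_arc by (cases x) (simp_all add: value_of_def)
qed

lemma value_of_append:
  assumes "x \<noteq> []" "set x \<subseteq> codes" "y \<noteq> []" "set y \<subseteq> codes"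
  shows "value_of (x @ y) = rees_mult S P (value_of x) (value_of y)"
proof -
  obtain b z where y: "y = b # z" using assms by (cases y) auto
  have "value_of (x @ y) = foldl (rees_mult S P) (value_of x) (map letter_value y)"
    using assms by (simp add: value_of_def)
  also have "\<dots> = foldl (rees_mult S P) (rees_mult S P (value_of x) (letter_value b))
      (map letter_value z)"
    by (simp add: y)
  also have "\<dots> = rees_mult S P (value_of x) (value_of y)"
    unfolding y value_of_def[of "b # z"] list.sel
    by (rule foldl_assoc[symmetric, of "arcs M"])
      (use assms y letter_value_arc value_of_closed in \<open>auto simp: rees_mult_closed rees_mult_assoc\<close>)
  finally show ?thesis .
qed

lemma value_of_single [simp]: "value_of [a] = letter_value a"
  by (simp add: value_of_def)

lemma chain_codes:
  assumes "x \<in> chain i l"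
  shows "x \<noteq> []" "set x \<subseteq> {a \<in> codes. decode a \<noteq> None}"
  using assms by (cases x; auto simp: chain_def starting_def inner_def)+

lemma chain_append:
  assumes "x @ [a] \<in> chain i l" "x \<noteq> []"
  shows "x \<in> chain i (end_row (last x))" "a \<in> inner" "end_row a = l" "last x \<in> nonfinal"
proof -
  have x: "hd x \<in> starting i" "set (tl x) \<subseteq> inner" "set x \<subseteq> nonfinal" "a \<in> ending l" "a \<in> inner"
    using assms by (auto simp: chain_def butlast_append)
  show "last x \<in> nonfinal" using x assms(2) last_in_set by blast
  then have "last x \<in> ending (end_row (last x))" by (auto simp: nonfinal_def ending_def)
  then show "x \<in> chain i (end_row (last x))"
    using x assms(2) in_set_butlastD[of _ x] by (auto simp: chain_def)
  show "a \<in> inner" "end_row a = l" using x by (simp_all add: ending_def)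
qed

text \<open>Induction from the right: if the last block has value \<open>mult S q s\<close>, then
  multiplication in \<open>M\<close> inserts exactly \<open>q\<close> before \<open>s\<close>, and
  associativity gives the value of the longer path.\<close>

lemma value_of_chain:
  assumes "x \<in> chain i l" "decoding x \<in> paths X"
  shows "value_of x = Some (i, \<rho> (decoding x), l)"
  using assms
proof (induction x arbitrary: l rule: rev_induct)
  case (snoc a x)
  show ?case
  proof (cases "x = []")
    case True
    then obtain b lo where "decode a = Some (Some i, b, lo)" "end_row a = l"
      using snoc.prems by (auto simp: chain_def starting_def ending_def)
    then show ?thesis using True by (simp add: letter_value_def block_def)
  next
    case False
    note c = chain_append[OF snoc.prems(1) False]
    obtain b lo where a: "a \<in> codes" "decode a = Some (None, b, lo)" using c(2) by (auto simp: inner_def)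
    have b: "b \<in> paths X" "\<rho> b \<in> right_ideal" "block a = b"
      using code_cases[OF a] a by (simp_all add: block_def)
    obtain io b' where a': "last x \<in> codes" "decode (last x) = Some (io, b', None)"
      using c(4) by (auto simp: nonfinal_def)
    have b': "b' \<noteq> []" "block (last x) = b'"
      using code_cases[OF a'] a' by (simp_all add: block_def X.paths_iff)
    have "decoding x = decoding (butlast x) @ b'"
      using decoding_simps(3)[of "butlast x" "[last x]"] False b' by simp
    then have dx: "decoding x \<noteq> []" "last (decoding x) = last b'" using b' by simp_all
    have p: "decoding x \<in> paths X" "head X (last b') = tail X (hd b)"
      using X.paths_append_iff[OF dx(1), of b] snoc.prems(2) b dx by (auto simp: X.paths_iff)
    \<comment> \<open>The preceding letter is not final, so its row is determined by the target of
      its block, which is the source of \<open>b\<close>.\<close>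
    have row: "end_row (last x) = row (tail S (\<rho> b))"
      using a' b' p(2) tail_rho[OF b(1)] by (simp add: end_row_def)
    have junction: "head S (\<rho> (decoding x)) = tail S (\<rho> b)"
      using head_rho[OF p(1)] dx(2) p(2) tail_rho[OF b(1)] by simp
    from b(2) obtain j s q where f: "factor (\<rho> b) = (j, s)" "s \<in> arcs S"
      "P (row (tail S (\<rho> b))) j = Some q" "q \<in> arcs S" "head S q = F j" "F j = tail S s"
      "\<rho> b = mult S q s"
      by (rule factorE)
    have "value_of (x @ [a]) =
        rees_mult S P (Some (i, \<rho> (decoding x), end_row (last x))) (Some (j, s, l))"
      using value_of_append[of x "[a]"] False chain_codes[OF c(1)] a snoc.IH[OF c(1) p(1)] f(1) c(3)
      by (auto simp: letter_value_def)
    also have "\<dots> = Some (i, mult S (mult S (\<rho> (decoding x)) q) s, l)"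
      using f(3) row by simp
    also have "mult S (mult S (\<rho> (decoding x)) q) s = mult S (\<rho> (decoding x)) (\<rho> b)"
      using mult_assoc[of "\<rho> (decoding x)" q s] f rho_closed[OF p(1)] junction by (simp add: tail_mult)
    also have "\<dots> = \<rho> (decoding (x @ [a]))"
      using rho_append[OF p(1) b(1)] dx p(2) b(3) by simp
    finally show ?thesis .
  qed
qed (simp add: chain_def)

text \<open>Full blocks are cut off from the left; only the last one records the row index
  \<open>l\<close>, which may lie outside the cross-section.\<close>

lemma ex_closed_tail:
  assumes "length w = Suc n * block_length" "w \<in> paths X"
    and "\<And>p b q. w = p @ b @ q \<Longrightarrow> length b = block_length \<Longrightarrow> \<rho> b \<in> right_ideal"
    and l: "l \<in> \<Lambda>" "G l = head X (last w)"
  shows "\<exists>x. x \<noteq> [] \<and> set x \<subseteq> inner \<and> set (butlast x) \<subseteq> nonfinal \<and> last x \<in> final l \<and> decoding x = w"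
  using assms
proof (induction n arbitrary: w)
  case 0
  have "\<rho> w \<in> right_ideal" using 0(3)[of "[]" w "[]"] 0(1) by simp
  then have "Some (None, w, Some l) \<in> letters" using 0 by (simp add: letters_def)
  then obtain a where "a \<in> codes" "decode a = Some (None, w, Some l)" using ex_code by blast
  then show ?case by (intro exI[of _ "[a]"]) (simp add: inner_def final_def block_def)
next
  case (Suc n)
  let ?b = "take block_length w" and ?r = "drop block_length w"
  have len: "length ?b = block_length" "length ?r = Suc n * block_length" using Suc.prems(1) by simp_all
  have ne: "?b \<noteq> []" "?r \<noteq> []" using len by (auto simp: block_length_def)
  have p: "?b \<in> paths X" "?r \<in> paths X" using X.paths_append_iff[OF ne] Suc.prems(2) by simp_all
  have "\<rho> ?b \<in> right_ideal" using Suc.prems(3)[of "[]" ?b ?r] len by simp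
  then have "Some (None, ?b, None) \<in> letters" using p len by (simp add: letters_def)
  then obtain a where a: "a \<in> codes" "decode a = Some (None, ?b, None)" using ex_code by blast
  have "last ?r = last w" using ne by simp
  then obtain x where x: "x \<noteq> []" "set x \<subseteq> inner" "set (butlast x) \<subseteq> nonfinal" "last x \<in> final l"
    "decoding x = ?r"
    using Suc.IH[OF len(2) p(2)] Suc.prems(3)[of "?b @ _"] l Suc.prems(5)
    by (metis append.assoc append_take_drop_id)
  then show ?case
    using a by (intro exI[of _ "a # x"]) (simp add: inner_def nonfinal_def block_def)
qed

lemma final_subset_ending: "final l \<subseteq> ending l"
  by (auto simp: final_def ending_def end_row_def)

lemma ex_word:
  assumes t: "t \<in> arcs S" and i: "i \<in> I" "F i = tail S t" and l: "l \<in> \<Lambda>" "head S t = G l"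
  shows "\<exists>x\<in>words i l. \<rho> (decoding x) = t"
proof -
  obtain w where w: "w \<in> K" "\<rho> w = t"
    and good: "\<And>p b q. w = p @ b @ q \<Longrightarrow> length b = block_length \<Longrightarrow> \<rho> b \<in> right_ideal"
    using representative_with_factors_in_right_ideal[of right_ideal t] mult_in_right_ideal t by blast
  have wp: "w \<in> paths X" using w K_paths by blast
  then have wne: "w \<noteq> []" by (simp add: X.paths_iff)
  have ends: "F i = tail X (hd w)" "G l = head X (last w)"
    using i l w tail_rho[OF wp] head_rho[OF wp] by simp_all
  show ?thesis
  proof (cases "length w \<le> block_length")
    case True
    then have "Some (Some i, w, Some l) \<in> letters" using wp ends i l by (simp add: letters_def)
    then obtain a where a: "a \<in> codes" "decode a = Some (Some i, w, Some l)" using ex_code by blast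
    then have "[a] \<in> words i l"
      using w final_subset_ending by (auto simp: words_def chain_def starting_def final_def block_def)
    then show ?thesis using a w by (intro bexI[of _ "[a]"]) (simp_all add: block_def)
  next
    case False
    \<comment> \<open>Dividing \<open>length w - 1\<close> instead of \<open>length w\<close> gives
      a first block of length \<open>k\<close> between 1 and \<open>block_length\<close>, never
      empty. It takes the remainder because its value need not factor.\<close>
    define n where "n = (length w - 1) div block_length"
    define k where "k = Suc ((length w - 1) mod block_length)"
    have C: "block_length > 0" by (simp add: block_length_def)
    have len: "length w = k + n * block_length"
      using wne by (simp add: k_def n_def Suc_leI)
    have k: "0 < k" "k \<le> block_length" using C by (simp_all add: k_def Suc_leI)
    obtain m where m: "n = Suc m" using len False k by (cases n) auto
    let ?b = "take k w" and ?r = "drop k w"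
    have lens: "length ?b = k" "length ?r = Suc m * block_length" using len m by simp_all
    have ne: "?b \<noteq> []" "?r \<noteq> []" using lens k C by auto
    have p: "?b \<in> paths X" "?r \<in> paths X" using X.paths_append_iff[OF ne] wp by simp_all
    have "hd ?b = hd w" "last ?r = last w" using ne by simp_all
    have "Some (Some i, ?b, None) \<in> letters" using p ends i k lens by (simp add: letters_def)
    then obtain a where a: "a \<in> codes" "decode a = Some (Some i, ?b, None)" using ex_code by blast
    obtain x where x: "x \<noteq> []" "set x \<subseteq> inner" "set (butlast x) \<subseteq> nonfinal" "last x \<in> final l"
      "decoding x = ?r"
      using ex_closed_tail[OF lens(2) p(2)] good[of "?b @ _"] l ends \<open>last ?r = last w\<close>
      by (metis append.assoc append_take_drop_id)
    then have "a # x \<in> words i l"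
      using a w final_subset_ending
      by (auto simp: words_def chain_def starting_def nonfinal_def block_def)
    then show ?thesis using a x w by (intro bexI[of _ "a # x"]) (simp_all add: block_def)
  qed
qed

end

subsection \<open>The language of representatives\<close>

context rees_coding
begin

definition code_graph :: "(unit, nat) pre_digraph" where
  "code_graph = \<lparr>verts = {()}, arcs = codes, tail = (\<lambda>_. ()), head = (\<lambda>_. ())\<rparr>"

lemma code_graph_simps [simp]: "verts code_graph = {()}" "arcs code_graph = codes"
  by (simp_all add: code_graph_def)

lemma fin_digraph_code_graph: "fin_digraph code_graph"
  by unfold_locales (simp_all add: codes_def)

lemma paths_code_graph: "paths code_graph = {x. x \<noteq> [] \<and> set x \<subseteq> codes}"
proof -
  interpret C: fin_digraph code_graph by (rule fin_digraph_code_graph)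
  have "successively (\<lambda>a b. head code_graph a = tail code_graph b) p" for p
    by (rule successively_if_sorted_wrt) (simp add: sorted_wrt_iff_nth_less)
  then show ?thesis by (auto simp: C.paths_iff)
qed

text \<open>The outer indices of an element of \<open>M\<close>, with \<open>None\<close> for the
  zero. Splitting by them reduces each relation to finitely many cases.\<close>

definition classes :: "('i \<times> 'l) option set" where
  "classes = insert None (Some ` (I \<times> \<Lambda>))"

lemma finite_classes: "finite classes"
  using finite_I finite_\<Lambda> by (simp add: classes_def)

fun word_class :: "('i \<times> 'l) option \<Rightarrow> nat list set" where
  "word_class None = {[zero]}"
| "word_class (Some (i, l)) = words i l"

definition language :: "nat list set" where
  "language = (\<Union>c\<in>classes. word_class c)"

fun prefix_class :: "('i \<times> 'l) option \<Rightarrow> nat list set" where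
  "prefix_class None = {[zero]}"
| "prefix_class (Some (i, l)) =
     Pref language \<inter> {x. x \<noteq> [] \<and> hd x \<in> starting i} \<inter> {x. x \<noteq> [] \<and> last x \<in> ending l}"

lemma recognizable_words: "recognizable (words i l)"
  unfolding words_def chain_def decoding_def
  by (intro recognizable_Int recognizable_hd recognizable_tl recognizable_butlast recognizable_last
      recognizable_vimage_concat recognizable_K)

lemma recognizable_word_class: "recognizable (word_class c)"
  by (induction c rule: word_class.induct) (simp_all add: recognizable_singleton recognizable_words)

lemma recognizable_language: "recognizable language"
  unfolding language_def by (intro recognizable_UN finite_classes recognizable_word_class)

lemma recognizable_prefix_class: "recognizable (prefix_class c)"
  by (induction c rule: prefix_class.induct)
    (simp_all add: recognizable_singleton recognizable_Int recognizable_Pref recognizable_language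
      recognizable_hd recognizable_last)

lemma wordsD:
  assumes "x \<in> words i l"
  shows "x \<in> chain i l" "decoding x \<in> K" "value_of x = Some (i, \<rho> (decoding x), l)"
  using assms value_of_chain[of x i l] K_paths by (auto simp: words_def)

lemma word_class_codes: "x \<in> word_class c \<Longrightarrow> x \<noteq> [] \<and> set x \<subseteq> codes"
  using zero chain_codes[OF wordsD(1), of x]
  by (cases c rule: word_class.cases) (simp, fastforce)

lemma block_nonempty: "a \<in> codes \<Longrightarrow> decode a \<noteq> None \<Longrightarrow> block a \<noteq> []"
  using code_cases(1) by (fastforce simp: block_def X.paths_iff)

lemma decoding_nonempty:
  assumes "x \<noteq> []" "set x \<subseteq> {a \<in> codes. decode a \<noteq> None}"
  shows "decoding x \<noteq> []"
  using assms by (cases x) (auto simp: block_nonempty)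

lemma prefix_language_cases:
  assumes "v \<in> Pref language"
  obtains "v = [zero]"
  | i l w where "i \<in> I" "l \<in> \<Lambda>" "v @ w \<in> words i l" "v \<noteq> []"
proof -
  obtain w c where c: "c \<in> classes" "v @ w \<in> word_class c" "v \<noteq> []"
    using assms by (auto simp: Pref_def language_def prefix_def)
  show ?thesis
  proof (cases c)
    case None
    then show ?thesis using that(1) c by (cases v) auto
  next
    case (Some il)
    then show ?thesis using that(2) c by (cases il) (auto simp: classes_def)
  qed
qed

text \<open>Decoding sends prefixes to prefixes, and a non-empty prefix of a chain is a chain,
  possibly with another end row.\<close>

lemma prefix_classD:
  assumes "v \<in> prefix_class (Some (i, l))"
  shows "v \<in> chain i l" "decoding v \<in> Pref K" "value_of v = Some (i, \<rho> (decoding v), l)"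
proof -
  have v: "v \<in> Pref language" "v \<noteq> []" "hd v \<in> starting i" "last v \<in> ending l" using assms by simp_all
  from v(1) have "v \<in> chain i l \<and> decoding v \<in> Pref K"
  proof (cases rule: prefix_language_cases)
    case 1
    then show ?thesis using v zero by (simp add: starting_def)
  next
    case (2 i' l' w)
    have vw: "v @ w \<in> chain i' l'" "decoding v @ decoding w \<in> K" using wordsD[OF 2(3)] by simp_all
    have "set (butlast v) \<subseteq> set (butlast (v @ w))" by (auto simp: butlast_append dest: in_set_butlastD)
    then have "v \<in> chain i l" using vw v by (auto simp: chain_def)
    moreover have "decoding v \<noteq> []" using decoding_nonempty v(2) chain_codes[OF vw(1)] by simp
    ultimately show ?thesis using vw(2) by (auto simp: Pref_def intro!: bexI[OF _ vw(2)])
  qed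
  then show chain: "v \<in> chain i l" and Pref: "decoding v \<in> Pref K" by simp_all
  have "decoding v \<in> paths X"
  proof -
    obtain w where w: "decoding v @ w \<in> paths X" "decoding v \<noteq> []"
      using Pref K_paths by (auto simp: Pref_def prefix_def)
    then show ?thesis using X.paths_append_iff[of "decoding v" w] by (cases "w = []") auto
  qed
  then show "value_of v = Some (i, \<rho> (decoding v), l)" by (rule value_of_chain[OF chain])
qed

lemma Pref_language: "Pref language = (\<Union>c\<in>classes. prefix_class c)"
proof (intro equalityI subsetI)
  fix v assume v: "v \<in> Pref language"
  then show "v \<in> (\<Union>c\<in>classes. prefix_class c)"
  proof (cases rule: prefix_language_cases)
    case 1
    then show ?thesis by (auto simp: classes_def)
  next
    case (2 i l w)
    have c: "v @ w \<in> chain i l" using wordsD[OF 2(3)] by simp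
    have last: "last v \<in> codes" "decode (last v) \<noteq> None"
      using chain_codes[OF c] last_in_set[OF 2(4)] by auto
    then have "end_row (last v) \<in> \<Lambda>" using end_row(1) by (metis prod_cases3 not_None_eq)
    moreover have "hd v \<in> starting i" using c 2(4) by (simp add: chain_def)
    moreover have "last v \<in> ending (end_row (last v))" using last by (simp add: ending_def)
    ultimately have "v \<in> prefix_class (Some (i, end_row (last v)))" using v 2(4) by simp
    then show ?thesis using 2(1) \<open>end_row (last v) \<in> \<Lambda>\<close> by (auto simp: classes_def)
  qed
next
  fix v assume "v \<in> (\<Union>c\<in>classes. prefix_class c)"
  then obtain c where c: "v \<in> prefix_class c" by blast
  show "v \<in> Pref language"
  proof (cases c)
    case None
    have "[zero] \<in> language" by (auto simp: language_def classes_def intro!: bexI[of _ None])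
    then show ?thesis using c None by (auto simp: Pref_def)
  qed (use c in auto)
qed

section \<open>Synchronous relations on the representatives\<close>

lemma synchronous_vimage_decoding:
  assumes "synchronous R" "recognizable U" "recognizable V" "U \<subseteq> chain i l" "V \<subseteq> chain i' l'"
  shows "synchronous {(u, v). u \<in> U \<and> v \<in> V \<and> (decoding u, decoding v) \<in> R}"
proof -
  \<comment> \<open>The zero letter is left out because its block is empty.\<close>
  define A where "A = {a \<in> codes. decode a \<noteq> None}"
  let ?R = "{(x, y). set x \<subseteq> A \<and> set (tl x) \<subseteq> inner \<and> set y \<subseteq> A \<and> set (tl y) \<subseteq> inner \<and>
      (concat (map block x), concat (map block y)) \<in> R}"
  have "synchronous ?R"
  proof (rule synchronous_vimage_blocks[OF assms(1), where C = block_length])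
    show "finite (\<Union>a\<in>A. set (block a))" by (simp add: A_def codes_def)
    show "0 < length (block a) \<and> length (block a) \<le> block_length" if "a \<in> A" for a
      using that block_nonempty[of a] code_cases(2)[of a] by (auto simp: A_def block_def)
    show "inner \<subseteq> A" by (auto simp: A_def inner_def)
    show "length (block a) = block_length" if "a \<in> inner" for a
      using that code_cases(3)[of a] by (auto simp: inner_def block_def)
  qed
  moreover have "{(u, v). u \<in> U \<and> v \<in> V \<and> (decoding u, decoding v) \<in> R} = (U \<times> V) \<inter> ?R"
  proof -
    have "set x \<subseteq> A \<and> set (tl x) \<subseteq> inner" if "x \<in> chain j m" for x j m
      using chain_codes[OF that] that by (simp add: A_def chain_def)
    then have "set x \<subseteq> A \<and> set (tl x) \<subseteq> inner" if "x \<in> U \<or> x \<in> V" for x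
      using that assms(4,5) by blast
    then show ?thesis by (auto simp: decoding_def)
  qed
  ultimately show ?thesis by (simp add: synchronous_Int synchronous_Times assms)
qed

lemma synchronous_classes:
  assumes "\<And>c d. c \<in> classes \<Longrightarrow> d \<in> classes \<Longrightarrow> synchronous {(u, v). u \<in> A c \<and> v \<in> B d \<and> Q u v}"
  shows "synchronous {(u, v). u \<in> (\<Union>c\<in>classes. A c) \<and> v \<in> (\<Union>d\<in>classes. B d) \<and> Q u v}"
proof -
  have "{(u, v). u \<in> (\<Union>c\<in>classes. A c) \<and> v \<in> (\<Union>d\<in>classes. B d) \<and> Q u v} =
      (\<Union>c\<in>classes. \<Union>d\<in>classes. {(u, v). u \<in> A c \<and> v \<in> B d \<and> Q u v})" by auto
  then show ?thesis using assms by (simp add: synchronous_UN finite_classes)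
qed

text \<open>For pairs of classes where the outer indices or the zero alone decide whether the values
  agree.\<close>

lemma synchronous_constant:
  assumes "recognizable A" "recognizable B" "\<And>u v. u \<in> A \<Longrightarrow> v \<in> B \<Longrightarrow> Q u v \<longleftrightarrow> q"
  shows "synchronous {(u, v). u \<in> A \<and> v \<in> B \<and> Q u v}"
proof -
  have "{(u, v). u \<in> A \<and> v \<in> B \<and> Q u v} = (if q then A \<times> B else {})" using assms(3) by auto
  then show ?thesis using assms by (simp add: synchronous_Times)
qed

lemma chain_words: "words i l \<subseteq> chain i l"
  using wordsD(1) by blast

lemma chain_prefix_class: "prefix_class (Some (i, l)) \<subseteq> chain i l"
  using prefix_classD(1) by blast

text \<open>Within one non-zero class, equality of values is equality in \<open>S\<close> of the
  decoded paths. Otherwise the values agree only when both are zero.\<close>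

lemma synchronous_language_eq:
  "synchronous {(u, v). u \<in> language \<and> v \<in> language \<and> value_of u = value_of v}"
  unfolding language_def
proof (rule synchronous_classes)
  fix c d :: "('i \<times> 'l) option"
  note const = synchronous_constant[OF recognizable_word_class recognizable_word_class]
  show "synchronous {(u, v). u \<in> word_class c \<and> v \<in> word_class d \<and> value_of u = value_of v}"
  proof (cases "\<exists>i l. c = Some (i, l) \<and> d = Some (i, l)")
    case True
    then obtain i l where "c = Some (i, l)" "d = Some (i, l)" by blast
    then have "{(u, v). u \<in> word_class c \<and> v \<in> word_class d \<and> value_of u = value_of v} =
        {(u, v). u \<in> words i l \<and> v \<in> words i l \<and>
          (decoding u, decoding v) \<in> {(u, v). u \<in> K \<and> v \<in> K \<and> \<rho> u = \<rho> v}}"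
      using wordsD by auto
    then show ?thesis
      using synchronous_vimage_decoding[OF synchronous_rel_eq recognizable_words recognizable_words
          chain_words chain_words] by simp
  next
    case False
    then show ?thesis
      by (intro const[where q = "c = None \<and> d = None"]; cases c; cases d) (auto dest!: wordsD(3))
  qed
qed

text \<open>The second word is classified by its end row, so that equal values again mean equal
  outer indices and, for the decodings, the prefix relation of \<open>K\<close>.\<close>

lemma synchronous_language_prefix:
  assumes "synchronous (rel_prefix K \<rho>)"
  shows "synchronous (rel_prefix language value_of)"
proof -
  have "synchronous {(u, v). u \<in> (\<Union>c\<in>classes. word_class c) \<and> v \<in> (\<Union>c\<in>classes. prefix_class c) \<and>
      value_of u = value_of v}"
  proof (rule synchronous_classes)
    fix c d :: "('i \<times> 'l) option"
    note const = synchronous_constant[OF recognizable_word_class recognizable_prefix_class]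
    show "synchronous {(u, v). u \<in> word_class c \<and> v \<in> prefix_class d \<and> value_of u = value_of v}"
    proof (cases "\<exists>i l. c = Some (i, l) \<and> d = Some (i, l)")
      case True
      then obtain i l where cd: "c = Some (i, l)" "d = Some (i, l)" by blast
      have "{(u, v). u \<in> word_class c \<and> v \<in> prefix_class d \<and> value_of u = value_of v} =
          {(u, v). u \<in> words i l \<and> v \<in> prefix_class d \<and> (decoding u, decoding v) \<in> rel_prefix K \<rho>}"
        using wordsD prefix_classD by (auto simp: rel_prefix_def cd simp del: prefix_class.simps)
      then show ?thesis
        using synchronous_vimage_decoding[OF assms recognizable_words recognizable_prefix_class
            chain_words chain_prefix_class] cd by simp
    next
      case False
      then show ?thesis
        by (intro const[where q = "c = None \<and> d = None"]; cases c; cases d)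
          (auto dest!: wordsD(3) prefix_classD(3) simp del: prefix_class.simps(2))
    qed
  qed
  then show ?thesis by (simp add: rel_prefix_def Pref_language language_def[symmetric])
qed

lemma language_codes: "language \<subseteq> paths code_graph"
  using word_class_codes by (auto simp: language_def paths_code_graph)

lemma letter_value_cases:
  assumes "a \<in> codes"
  obtains "letter_value a = None"
  | j c m where "letter_value a = Some (j, c, m)" "j \<in> I" "c \<in> arcs S" "F j = tail S c"
  using letter_value_arc[OF assms] by (auto simp: rees_matrix_semigroup_def)

text \<open>On words ending in row \<open>l\<close>, a letter of value \<open>(j, s, m)\<close>
  either gives zero or multiplies the middle coordinate by the fixed arrow
  \<open>mult S p s\<close>, where \<open>p\<close> is the entry at \<open>l\<close> and
  \<open>j\<close>.\<close>

lemma synchronous_language_edge: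
  assumes a: "a \<in> codes"
  shows "synchronous (rel_edge code_graph language value_of a)"
proof -
  have mult: "value_of (u @ [a]) = rees_mult S P (value_of u) (letter_value a)" if "u \<in> word_class c" for u c
    using value_of_append[of u "[a]"] word_class_codes[OF that] a by simp
  have "synchronous {(u, v). u \<in> (\<Union>c\<in>classes. word_class c) \<and> v \<in> (\<Union>c\<in>classes. word_class c) \<and>
      value_of (u @ [a]) = value_of v}"
  proof (rule synchronous_classes)
    fix c d :: "('i \<times> 'l) option"
    assume cd: "c \<in> classes" "d \<in> classes"
    note const = synchronous_constant[OF recognizable_word_class recognizable_word_class]
    let ?R = "{(u, v). u \<in> word_class c \<and> v \<in> word_class d \<and> value_of (u @ [a]) = value_of v}"
    \<comment> \<open>If the product always vanishes, it matches exactly the zero class.\<close>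
    have zero: "synchronous ?R" if "\<And>u. u \<in> word_class c \<Longrightarrow> value_of (u @ [a]) = None"
      using that by (intro const[where q = "d = None"]; cases d) (auto dest!: wordsD(3))
    show "synchronous ?R"
    proof (cases c)
      case None
      then have "value_of u = None" if "u \<in> word_class c" for u using that by simp
      then show ?thesis by (intro zero) (simp only: mult[of _ c] rees_mult.simps)
    next
      case (Some il)
      then obtain i l where c: "c = Some (i, l)" by (cases il) auto
      show ?thesis
        using a
      proof (cases rule: letter_value_cases)
        case 1
        then show ?thesis by (intro zero) (simp add: mult[of _ c])
      next
        case (2 j s m)
        show ?thesis
        proof (cases "P l j")
          case None
          have "value_of (u @ [a]) = None" if "u \<in> word_class c" for u
            using mult[OF that] wordsD(3)[of u i l] that c 2(1) None by simp
          then show ?thesis by (rule zero)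
        next
          case (Some p)
          have l: "l \<in> \<Lambda>" using cd c by (auto simp: classes_def)
          have p: "p \<in> arcs S" "tail S p = G l" "head S p = F j" using P_entry[OF l 2(2) Some] by auto
          have u: "value_of (u @ [a]) = Some (i, mult S (\<rho> (decoding u)) (mult S p s), m)"
            "head X (last (decoding u)) = G l" if "u \<in> words i l" for u
          proof -
            have path: "decoding u \<in> paths X" using wordsD[OF that] K_paths by blast
            have "value_of u \<in> arcs M"
              using value_of_closed word_class_codes[of u c] that c by simp
            then show head: "head X (last (decoding u)) = G l"
              using wordsD(3)[OF that] head_rho[OF path] by (auto simp: rees_matrix_semigroup_def)
            then show "value_of (u @ [a]) = Some (i, mult S (\<rho> (decoding u)) (mult S p s), m)"
              using mult[of u c] that c wordsD(3)[OF that] 2 Some p path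
              by (simp add: mult_assoc rho_closed head_rho)
          qed
          show ?thesis
          proof (cases "d = Some (i, m)")
            case True
            have ps: "mult S p s \<in> arcs S" "tail S (mult S p s) = G l"
              using p 2 by (simp_all add: mult_closed tail_mult)
            have "?R = {(u, v). u \<in> words i l \<and> v \<in> words i m \<and> (decoding u, decoding v) \<in>
                {(u, v). u \<in> K \<and> v \<in> K \<and> head X (last u) = tail S (mult S p s) \<and>
                  mult S (\<rho> u) (mult S p s) = \<rho> v}}"
              using u wordsD ps c True by auto
            then show ?thesis
              using synchronous_vimage_decoding[OF synchronous_rel_arc[OF ps(1)] recognizable_words
                  recognizable_words chain_words chain_words] by simp
          next
            case False
            then show ?thesis
              by (intro const[where q = False]; cases d) (auto dest!: wordsD(3) simp: u c)
          qed
        qed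
      qed
    qed
  qed
  then show ?thesis by (simp add: rel_edge_def language_def code_graph_def)
qed

section \<open>The prefix-automatic structure of the Rees matrix semigroup\<close>

lemma value_of_language: "value_of ` language = arcs M"
proof (intro equalityI subsetI)
  fix m assume "m \<in> arcs M"
  then consider "m = None" | i x l where "m = Some (i, x, l)" "i \<in> I" "x \<in> arcs S" "l \<in> \<Lambda>"
    "F i = tail S x" "head S x = G l"
    by (auto simp: rees_matrix_semigroup_def)
  then show "m \<in> value_of ` language"
  proof cases
    case 1
    then show ?thesis
      by (intro image_eqI[of _ _ "[zero]"]) (auto simp: language_def classes_def intro!: bexI[of _ None])
  next
    case (2 i x l)
    then obtain w where w: "w \<in> words i l" "\<rho> (decoding w) = x" using ex_word by blast
    then have "w \<in> language"
      using 2 by (auto simp: language_def classes_def intro!: bexI[of _ "Some (i, l)"])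
    then show ?thesis using wordsD(3)[OF w(1)] w(2) 2(1) by (intro image_eqI[of _ _ w]) simp_all
  qed
qed (use value_of_closed language_codes in \<open>auto simp: paths_code_graph\<close>)

lemma choice_of_representatives_language:
  "choice_of_representatives M code_graph language value_of"
proof -
  interpret C: fin_digraph code_graph by (rule fin_digraph_code_graph)
  have closed: "value_of ` paths code_graph \<subseteq> arcs M"
    using value_of_closed by (auto simp: paths_code_graph)
  have "semigroupoid_hom (free_semigroupoid code_graph) M id value_of"
    using closed value_of_append unfolding semigroupoid_hom_def
    by (auto simp: free_semigroupoid_def rees_matrix_semigroup_def paths_code_graph)
  moreover have "value_of ` paths code_graph = arcs M"
    using closed value_of_language language_codes by blast
  ultimately show ?thesis
    using value_of_language language_codes C.wf_digraph_axioms
    by (simp add: choice_of_representatives_def rees_matrix_semigroup_def)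
qed

lemma prefix_automatic_structure_language:
  assumes "synchronously_regular X (rel_prefix K \<rho>)"
  shows "prefix_automatic_structure M code_graph language value_of"
proof -
  note iff = synchronously_regular_iff[OF fin_digraph_code_graph]
  have Pref: "Pref language \<subseteq> paths code_graph"
    using language_codes unfolding Pref_def paths_code_graph prefix_def by fastforce
  have "synchronously_regular code_graph (rel_edge code_graph language value_of a)" if "a \<in> codes" for a
    unfolding iff using synchronous_language_edge[OF that] language_codes by (auto simp: rel_edge_def)
  moreover have "synchronously_regular code_graph (rel_vertex code_graph language value_of a)" for a
    unfolding iff using synchronous_language_eq language_codes by (auto simp: rel_vertex_def)
  moreover have "synchronously_regular code_graph (rel_prefix language value_of)"
    unfolding iff using synchronous_language_prefix assms language_codes Pref
    by (auto simp: rel_prefix_def synchronously_regular_iff[OF fin_digraph_X])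
  ultimately show ?thesis
    using choice_of_representatives_language fin_digraph_code_graph
    by (simp add: prefix_automatic_structure_def automatic_structure_def)
qed

end

theorem theorem5p2:
  fixes S :: "('o, 'a) pre_semigroupoid"
    and I :: "'i set" and \<Lambda> :: "'l set"
    and F :: "'i \<Rightarrow> 'o" and G :: "'l \<Rightarrow> 'o"
    and P :: "'l \<Rightarrow> 'i \<Rightarrow> 'a option"
  assumes "rees_matrix_data S I \<Lambda> F G P"
    and "finitely_generated (rees_matrix_semigroup S I \<Lambda> F G P)"
    and "prefix_automatic S"
    and "weakly_right_ideal_generated S I \<Lambda> G P {s \<in> arcs S. \<not> identity_element S s}"
  shows "prefix_automatic (rees_matrix_semigroup S I \<Lambda> F G P)"
proof -
  interpret rees_matrix_data S I \<Lambda> F G P by fact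
  obtain X :: "('o, nat) pre_digraph" and K \<rho> where X: "prefix_automatic_structure S X K \<rho>"
    using assms(3) unfolding prefix_automatic_def by blast
  obtain \<Lambda>' where \<Lambda>': "\<Lambda>' \<subseteq> \<Lambda>" "bij_betw G \<Lambda>' (head S ` arcs S)"
    "\<forall>t \<in> {s \<in> arcs S. \<not> identity_element S s}. \<exists>l \<in> \<Lambda>'. \<exists>i \<in> I. \<exists>p. P l i = Some p \<and>
      (t = p \<or> (\<exists>s \<in> arcs S. head S p = tail S s \<and> t = mult S p s))"
    using assms(4) unfolding weakly_right_ideal_generated_def by blast
  interpret rees_coding S I \<Lambda> F G P X K \<rho> \<Lambda>'
  proof unfold_locales
    show "automatic_structure S X K \<rho>" using X by (simp add: prefix_automatic_structure_def)
    \<comment> \<open>Finite generation of \<open>M\<close> enters here.\<close>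
    show "finite I" "finite \<Lambda>" by (rule finite_index_sets[OF assms(2)])+
  qed (use \<Lambda>' in simp_all)
  have "synchronously_regular X (rel_prefix K \<rho>)"
    using X by (simp add: prefix_automatic_structure_def)
  then show ?thesis
    unfolding prefix_automatic_def using prefix_automatic_structure_language by blast
qed

end
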